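(* Let $\Omega_{-1}\subseteq\mathbb{R}^2$ be a simply connected planar domain, let $\widetilde\psi:\Omega_{-1}\to\mathbb{L}^3$, $\widetilde\psi(x,y)=(x,y,\overline u(x,y))$, be a $[\varphi,\vec e_3]$-maximal (spacelike) graph in $\mathbb{L}^3$, let $\overline W=\sqrt{1-\overline u_x^2-\overline u_y^2}$, let $\overline\phi:\Omega_{-1}\to\mathbb{R}$ be a solution of the system $$\overline\phi_{xx}=\frac{1-\overline u_x^2}{\overline W}e^{\varphi(\overline u)},\qquad \overline\phi_{xy}=-\frac{\overline u_x\overline u_y}{\overline W}e^{\varphi(\overline u)},\qquad \overline\phi_{yy}=\frac{1-\overline u_y^2}{\overline W}e^{\varphi(\overline u)},$$ and let $\vartheta$ be a primitive of $e^{\varphi}$. Then the immersion given by $$\psi:=(\overline\phi_x,\overline\phi_y,\vartheta(\overline u))$$ is a $[-\varphi\circ\vartheta^{-1},\vec e_3]$-minimal graph in $\mathbb{R}^3$ on the Legendre transform domain of $\overline\phi$, whose induced metric $g$, mean curvature $H$ and Gauss curvature $K$ satisfy $$g=\frac{e^{2\varphi(\overline u)}}{\overline W^2}\,\overline g,\qquad H+e^{-\varphi(\overline u)}\,\overline W^2\,\overline H=0,\qquad K+e^{-2\varphi(\overline u)}\,\overline W^4\,\overline K=0,$$ where $\overline g,\overline H,\overline K$ are the induced metric, the mean curvature and the Gauss curvature of the spacelike graph of $\overline u$.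
   Context: Let $\vec e_3=(0,0,1)$. $\mathbb{L}^3$ is $\mathbb{R}^3$ with the Lorentz metric $\ll\cdot,\cdot\gg=dx^2+dy^2-dz^2$; a surface in $\mathbb{L}^3$ is spacelike if its induced metric is positive definite. A graph is a surface that is the vertical graph of a function on a planar domain. The Legendre transform domain of $\overline\phi$ is the image of $(x,y)\mapsto(\overline\phi_x,\overline\phi_y)$. Here $\varphi$ is a smooth function depending only on the third coordinate; a dot denotes the derivative with respect to that coordinate. Mean curvature vectors are traces of the vector-valued second fundamental form (equivalently, the Laplacian of the immersion in the induced metric). A surface in $\mathbb{R}^3$ is $[\varphi,\vec e_3]$-minimal if its mean curvature vector is $(\overline\nabla\varphi)^\perp=\dot\varphi\,\vec e_3^{\perp}$, where $\perp$ is the projection to the normal bundle. A spacelike surface in $\mathbb{L}^3$ is $[\varphi,\vec e_3]$-maximal if its mean curvature vector is $(\overline\nabla^{\mathbb{L}^3}\varphi)^\perp$, where $\overline\nabla^{\mathbb{L}^3}$ is the gradient in $\mathbb{L}^3$. For a spacelike graph $(x,y,\overline u)$ this is equivalent to $(1-\overline u_x^2)\overline u_{yy}+(1-\overline u_y^2)\overline u_{xx}+2\overline u_x\overline u_y\overline u_{xy}+\dot\varphi(\overline u)\overline W^2=0$, which is the integrability condition of the system for $\overline\phi$ ($\overline\phi$ is convex and unique modulo linear polynomials). The Gauss maps are $\overline N=\frac1{\overline W}(\overline u_x,\overline u_y,1)$ for $\widetilde\psi$ and $N=(-\overline u_x,-\overline u_y,\overline W)$ for $\psi$; the shape operators are $\overline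 A=-d\overline N$ and $A=-dN$; the mean curvatures are $\overline H=\mathrm{tr}\,\overline A$, $H=\mathrm{tr}\,A$; the Gauss curvatures are those of the induced Riemannian metrics, so $\overline K=-\det\overline A$ and $K=\det A$.
   Formalization: The graph claim is false for some non-convex simply connected domains, so it is stated for each subdomain (the whole domain included) that is convex, or where φ̄ is convex or its gradient is injective; minimality and the g, H, K relations hold on the whole domain. *)

theory Defs
  imports "HOL-Analysis.Analysis"
begin

section \<open>Calculus on open sets\<close>

text \<open>On open sets only: derivatives are taken at points, not within \<open>S\<close>.\<close>

primrec Ck_on :: "nat \<Rightarrow> ('a::real_normed_vector \<Rightarrow> 'b::real_normed_vector) \<Rightarrow> 'a set \<Rightarrow> bool" where
  "Ck_on 0 f S \<longleftrightarrow> continuous_on S f"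
| "Ck_on (Suc k) f S \<longleftrightarrow>
     (\<forall>x\<in>S. f differentiable (at x)) \<and>
     (\<forall>v. Ck_on k (\<lambda>x. frechet_derivative f (at x) v) S)"

definition smooth_on :: "('a::real_normed_vector \<Rightarrow> 'b::real_normed_vector) \<Rightarrow> 'a set \<Rightarrow> bool" where
  "smooth_on f S \<longleftrightarrow> (\<forall>k. Ck_on k f S)"

text \<open>\<open>pd 1 f\<close> and \<open>pd 2 f\<close> are \<open>f\<^sub>x\<close> and \<open>f\<^sub>y\<close>; \<open>pd 2 (pd 1 f)\<close> is \<open>f\<^sub>x\<^sub>y\<close>.\<close>

definition pd :: "2 \<Rightarrow> (real^2 \<Rightarrow> 'b::real_normed_vector) \<Rightarrow> real^2 \<Rightarrow> 'b" where
  "pd i f p = frechet_derivative f (at p) (axis i 1)"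


section \<open>Parametrized surfaces in Euclidean and in Lorentz space\<close>

text \<open>A constant ambient metric on \<open>\<real>\<^sup>3\<close> is given by its bilinear form \<open>B\<close>:
  \<open>inner\<close> for Euclidean space, \<open>lorentz\<close> for \<open>\<bbbL>\<^sup>3\<close>.\<close>

definition lorentz :: "real^3 \<Rightarrow> real^3 \<Rightarrow> real" where
  "lorentz v w = v$1 * w$1 + v$2 * w$2 - v$3 * w$3"

definition immersion_on :: "(real^2 \<Rightarrow> real^3) \<Rightarrow> (real^2) set \<Rightarrow> bool" where
  "immersion_on X S \<longleftrightarrow>
     smooth_on X S \<and> (\<forall>p\<in>S. inj (frechet_derivative X (at p)))"

definition induced_metric ::
  "(real^3 \<Rightarrow> real^3 \<Rightarrow> real) \<Rightarrow> (real^2 \<Rightarrow> real^3) \<Rightarrow> real^2 \<Rightarrow> real^2^2" where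
  "induced_metric B X p = (\<chi> i j. B (pd i X p) (pd j X p))"

definition spacelike_on :: "(real^2 \<Rightarrow> real^3) \<Rightarrow> (real^2) set \<Rightarrow> bool" where
  "spacelike_on X S \<longleftrightarrow>
     (\<forall>p\<in>S. \<forall>v. v \<noteq> 0 \<longrightarrow> v \<bullet> (induced_metric lorentz X p *v v) > 0)"

text \<open>The \<open>B\<close>-orthogonal projection of \<open>w\<close> to the normal space of \<open>X\<close> at \<open>p\<close>; it exists and is
  unique if the induced metric is nondegenerate.\<close>

definition normal_part ::
  "(real^3 \<Rightarrow> real^3 \<Rightarrow> real) \<Rightarrow> (real^2 \<Rightarrow> real^3) \<Rightarrow> real^2 \<Rightarrow> real^3 \<Rightarrow> real^3" where
  "normal_part B X p w =
     (THE n. w - n \<in> range (frechet_derivative X (at p)) \<and>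
             (\<forall>t \<in> range (frechet_derivative X (at p)). B n t = 0))"

text \<open>The ambient connection is the flat one for both metrics, so the vector-valued second
  fundamental form on the coordinate fields is the normal part of the second partial derivative.\<close>

definition second_fundamental_form ::
  "(real^3 \<Rightarrow> real^3 \<Rightarrow> real) \<Rightarrow> (real^2 \<Rightarrow> real^3) \<Rightarrow> real^2 \<Rightarrow> 2 \<Rightarrow> 2 \<Rightarrow> real^3" where
  "second_fundamental_form B X p i j = normal_part B X p (pd i (pd j X) p)"

definition mean_curvature_vector ::
  "(real^3 \<Rightarrow> real^3 \<Rightarrow> real) \<Rightarrow> (real^2 \<Rightarrow> real^3) \<Rightarrow> real^2 \<Rightarrow> real^3" where
  "mean_curvature_vector B X p =
     (\<Sum>i\<in>UNIV. \<Sum>j\<in>UNIV.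
        matrix_inv (induced_metric B X p) $ i $ j *\<^sub>R second_fundamental_form B X p i j)"

definition ambient_gradient ::
  "(real^3 \<Rightarrow> real^3 \<Rightarrow> real) \<Rightarrow> (real^3 \<Rightarrow> real) \<Rightarrow> real^3 \<Rightarrow> real^3" where
  "ambient_gradient B F q = (THE G. \<forall>w. B G w = frechet_derivative F (at q) w)"

text \<open>The function \<open>f\<close> of the third coordinate lives on an open set \<open>J\<close> of heights, which need not be
  all of \<open>\<real>\<close>: this is essential for \<open>- \<phi> \<circ> \<theta>\<^sup>-\<^sup>1\<close>, defined on the range of \<open>\<theta>\<close> only.\<close>

definition weighted_stationary_on ::
  "(real^3 \<Rightarrow> real^3 \<Rightarrow> real) \<Rightarrow> real set \<Rightarrow> (real \<Rightarrow> real) \<Rightarrow> (real^2 \<Rightarrow> real^3) \<Rightarrow> (real^2) set \<Rightarrow> bool"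
where
  "weighted_stationary_on B J f X S \<longleftrightarrow>
     open J \<and> smooth_on f J \<and> immersion_on X S \<and> (\<forall>p\<in>S. X p $ 3 \<in> J) \<and>
     (\<forall>p\<in>S. mean_curvature_vector B X p =
              normal_part B X p (ambient_gradient B (\<lambda>q. f (q $ 3)) (X p)))"

definition minimal_on ::
  "real set \<Rightarrow> (real \<Rightarrow> real) \<Rightarrow> (real^2 \<Rightarrow> real^3) \<Rightarrow> (real^2) set \<Rightarrow> bool" where
  "minimal_on J f X S \<longleftrightarrow> weighted_stationary_on inner J f X S"

definition maximal_on ::
  "real set \<Rightarrow> (real \<Rightarrow> real) \<Rightarrow> (real^2 \<Rightarrow> real^3) \<Rightarrow> (real^2) set \<Rightarrow> bool" where
  "maximal_on J f X S \<longleftrightarrow> spacelike_on X S \<and> weighted_stationary_on lorentz J f X S"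


section \<open>Curvatures\<close>

text \<open>The shape operator \<open>- dN\<close>, as an endomorphism of the parameter plane via \<open>dX\<close>.\<close>

definition shape_operator ::
  "(real^2 \<Rightarrow> real^3) \<Rightarrow> (real^2 \<Rightarrow> real^3) \<Rightarrow> real^2 \<Rightarrow> real^2 \<Rightarrow> real^2" where
  "shape_operator X N p =
     (THE A. linear A \<and>
        (\<forall>v. frechet_derivative X (at p) (A v) = - frechet_derivative N (at p) v))"

definition mean_curvature :: "(real^2 \<Rightarrow> real^3) \<Rightarrow> (real^2 \<Rightarrow> real^3) \<Rightarrow> real^2 \<Rightarrow> real" where
  "mean_curvature X N p = trace (matrix (shape_operator X N p))"

text \<open>\<open>christoffel g k i j\<close> is \<open>\<Gamma>\<^sup>k\<^sub>i\<^sub>j\<close>, and \<open>riemann g l i j k\<close> is the \<open>l\<close>-th component of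
  \<open>R(\<partial>\<^sub>i, \<partial>\<^sub>j) \<partial>\<^sub>k\<close> with \<open>R(X, Y) = \<nabla>\<^sub>X \<nabla>\<^sub>Y - \<nabla>\<^sub>Y \<nabla>\<^sub>X - \<nabla>\<^bsub>[X,Y]\<^esub>\<close>; with this sign
  the round sphere has positive Gauss curvature.\<close>

definition christoffel :: "(real^2 \<Rightarrow> real^2^2) \<Rightarrow> 2 \<Rightarrow> 2 \<Rightarrow> 2 \<Rightarrow> real^2 \<Rightarrow> real" where
  "christoffel g k i j p =
     (\<Sum>l\<in>UNIV. matrix_inv (g p) $ k $ l *
        (pd i (\<lambda>q. g q $ j $ l) p + pd j (\<lambda>q. g q $ i $ l) p - pd l (\<lambda>q. g q $ i $ j) p)) / 2"

definition riemann :: "(real^2 \<Rightarrow> real^2^2) \<Rightarrow> 2 \<Rightarrow> 2 \<Rightarrow> 2 \<Rightarrow> 2 \<Rightarrow> real^2 \<Rightarrow> real" where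
  "riemann g l i j k p =
     pd i (christoffel g l j k) p - pd j (christoffel g l i k) p +
     (\<Sum>m\<in>UNIV. christoffel g l i m p * christoffel g m j k p
               - christoffel g l j m p * christoffel g m i k p)"

definition gauss_curvature :: "(real^2 \<Rightarrow> real^2^2) \<Rightarrow> real^2 \<Rightarrow> real" where
  "gauss_curvature g p = (\<Sum>l\<in>UNIV. g p $ l $ 1 * riemann g l 1 2 2 p) / det (g p)"


section \<open>Graphs and the dual surface\<close>

definition graph_param :: "(real^2 \<Rightarrow> real) \<Rightarrow> real^2 \<Rightarrow> real^3" where
  "graph_param u p = vector [p $ 1, p $ 2, u p]"

text \<open>\<open>X\<close> parametrizes, without self-intersections, the vertical graph of a smooth function
  on the planar domain \<open>D\<close>.\<close>

definition is_graph_over :: "(real^2 \<Rightarrow> real^3) \<Rightarrow> (real^2) set \<Rightarrow> (real^2) set \<Rightarrow> bool" where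
  "is_graph_over X S D \<longleftrightarrow>
     open D \<and> connected D \<and> inj_on X S \<and>
     (\<exists>v. smooth_on v D \<and> X ` S = graph_param v ` D)"

definition W_bar :: "(real^2 \<Rightarrow> real) \<Rightarrow> real^2 \<Rightarrow> real" where
  "W_bar u p = sqrt (1 - (pd 1 u p)\<^sup>2 - (pd 2 u p)\<^sup>2)"

definition lorentz_gauss_map :: "(real^2 \<Rightarrow> real) \<Rightarrow> real^2 \<Rightarrow> real^3" where
  "lorentz_gauss_map u p = (1 / W_bar u p) *\<^sub>R vector [pd 1 u p, pd 2 u p, 1]"

text \<open>The Gauss map of the dual surface, expressed through \<open>u\<close>.\<close>

definition dual_gauss_map :: "(real^2 \<Rightarrow> real) \<Rightarrow> real^2 \<Rightarrow> real^3" where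
  "dual_gauss_map u p = vector [- pd 1 u p, - pd 2 u p, W_bar u p]"

definition dual_surface ::
  "(real^2 \<Rightarrow> real) \<Rightarrow> (real \<Rightarrow> real) \<Rightarrow> (real^2 \<Rightarrow> real) \<Rightarrow> real^2 \<Rightarrow> real^3" where
  "dual_surface \<phi>b \<theta> u p = vector [pd 1 \<phi>b p, pd 2 \<phi>b p, \<theta> (u p)]"

definition legendre_map :: "(real^2 \<Rightarrow> real) \<Rightarrow> real^2 \<Rightarrow> real^2" where
  "legendre_map \<phi>b p = vector [pd 1 \<phi>b p, pd 2 \<phi>b p]"

abbreviation legendre_domain :: "(real^2 \<Rightarrow> real) \<Rightarrow> (real^2) set \<Rightarrow> (real^2) set" where
  "legendre_domain \<phi>b S \<equiv> legendre_map \<phi>b ` S"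

text \<open>Convexity on a set that need not be convex: being the restriction of a convex function.
  For convex \<open>S\<close> this is \<open>convex_on S f\<close>.\<close>

definition convex_function_on :: "(real^2) set \<Rightarrow> (real^2 \<Rightarrow> real) \<Rightarrow> bool" where
  "convex_function_on S f \<longleftrightarrow> (\<exists>F. convex_on (convex hull S) F \<and> (\<forall>p\<in>S. F p = f p))"

text \<open>A positive definite Hessian on a simply connected but non-convex domain forces the
  gradient to be locally, not globally, injective. For example take \<open>\<phi> = 0\<close> and small \<open>\<epsilon> > 0\<close>, and
  the harmonic map \<open>h + cnj g\<close> with \<open>h = z + \<epsilon> log z / (2\<pi>i)\<close>, \<open>g = \<epsilon> log z / (2\<pi>i)\<close> on a thin
  annular strip \<open>1 < |z| < 1 + w\<close>, \<open>-\<delta> < arg z < 2\<pi> + \<delta>\<close>. It equals \<open>z + \<epsilon> arg z / \<pi>\<close>, and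
  with \<open>u = 2 Re (\<integral> sqrt (h' g') dz)\<close> it parametrizes a maximal graph over an embedded strip.
  The gradient of \<open>\<phi>b\<close> is \<open>h - cnj g = z + \<epsilon> log |z| / (\<pi>i)\<close>, which takes the same value on both
  ends of the strip, where \<open>u\<close> takes different values. So the dual surface is a graph only over
  the subdomains on which the Legendre transform of \<open>\<phi>b\<close> is single-valued. This is the case on
  every convex subdomain (in particular near every point, and on the whole domain if it is convex),
  and wherever \<open>\<phi>b\<close> is convex or, most generally, has an injective gradient.\<close>

definition legendre_admissible :: "(real^2 \<Rightarrow> real) \<Rightarrow> (real^2) set \<Rightarrow> bool" where
  "legendre_admissible \<phi>b U \<longleftrightarrow>
     convex U \<or> convex_function_on U \<phi>b \<or> inj_on (legendre_map \<phi>b) U"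

end

theory Submission
  imports Defs
begin

text \<open>Write \<open>(a, b)\<close> for the gradient of \<open>u\<close> and \<open>E = exp (\<phi> u)\<close>. The system for \<open>\<phi>b\<close> gives the
  coordinate fields of the dual surface \<open>Y\<close> explicitly, and they are orthogonal to
  \<open>N = (- a, - b, W)\<close>. Differentiating this orthogonality yields the second fundamental form
  \<open>(E / W) u\<^sub>i\<^sub>j\<close>, so that, up to conformal factors, both mean curvatures are the trace of the
  Hessian of \<open>u\<close> with respect to the metric of the graph, which the maximal surface equation
  computes. For the intrinsic Gauss curvatures the Christoffel symbols are eliminated by the
  Brioschi identity, which needs no unit normal and so covers both ambient metrics at once; the
  rest is the Gauss equation. The Hessian of \<open>\<phi>b\<close> is a positive multiple of the (spacelike) metric
  of the graph, hence the Legendre map is injective on admissible sets and a diffeomorphism onto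
  its open image, over which \<open>Y\<close> is the graph of \<open>\<theta> \<circ> u\<close> composed with the inverse.\<close>

section \<open>Functions of class \<open>C\<^sup>k\<close>\<close>

text \<open>The square root in \<open>W\<close> would keep the curvature identities from being
  polynomial. It is treated as an unknown that enters them through
  \<open>W * W = 1 - a * a - b * b\<close> and the derivative of this relation; once divisions are
  collected in common factors, \<open>algebra\<close> decides what remains. The curvatures then
  depend on two expressions in the Hessian of \<open>u\<close>, the trace T =
  \<open>hessian_trace\<close> and the determinant D: they are T / (E W) and D / E^2 for the dual
  surface, - T / W^3 and - D / W^4 for the graph, and the two relations can be read off. The
  inverses of \<theta> and of the Legendre map are handled by one argument. Smoothness is tested one
  direction at a time on real functions composed with the inverse, so that an explicit inverse
  Jacobian suffices and no operator-valued map has to be differentiated.\<close>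

lemma Ck_on_cong:
  assumes "open S" "Ck_on k f S" "\<And>x. x \<in> S \<Longrightarrow> f x = g x"
  shows "Ck_on k g S"
  using assms(2,3)
proof (induction k arbitrary: f g)
  case 0
  then show ?case by (auto cong: continuous_on_cong)
next
  case (Suc k)
  have d: "(g has_derivative frechet_derivative f (at x)) (at x)" if "x \<in> S" for x
    using has_derivative_transform_within_open[OF _ assms(1) that, of f "frechet_derivative f (at x)" UNIV g]
      Suc.prems that by (auto simp: frechet_derivative_works)
  then have "frechet_derivative f (at x) v = frechet_derivative g (at x) v" if "x \<in> S" for x v
    using frechet_derivative_at that by metis
  then have "Ck_on k (\<lambda>x. frechet_derivative g (at x) v) S" for v
    using Suc.IH[of "\<lambda>x. frechet_derivative f (at x) v"] Suc.prems by simp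
  then show ?case using d by (auto simp: differentiable_def)
qed

text \<open>\<open>frechet_derivative\<close> is a choice operator, so the closure rules compute a
  derivative \<open>f'\<close> by hand; uniqueness of derivatives identifies the two on
  \<open>S\<close>. The inductions on \<open>k\<close> for sums, products and composites go through
  this rule.\<close>

lemma Ck_on_SucI:
  assumes "open S" "\<And>x. x \<in> S \<Longrightarrow> (f has_derivative f' x) (at x)"
    "\<And>v. Ck_on k (\<lambda>x. f' x v) S"
  shows "Ck_on (Suc k) f S"
proof -
  have "f' x v = frechet_derivative f (at x) v" if "x \<in> S" for x v
    using assms(2)[OF that] frechet_derivative_at by metis
  then have "Ck_on k (\<lambda>x. frechet_derivative f (at x) v) S" for v
    using Ck_on_cong[OF assms(1,3)] by simp
  then show ?thesis
    using assms(2) by (auto simp: differentiable_def)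
qed

lemma Ck_on_has_derivative:
  "Ck_on (Suc k) f S \<Longrightarrow> x \<in> S \<Longrightarrow> (f has_derivative frechet_derivative f (at x)) (at x)"
  by (auto simp: frechet_derivative_works)

lemma Ck_on_frechet_derivative:
  "Ck_on (Suc k) f S \<Longrightarrow> Ck_on k (\<lambda>x. frechet_derivative f (at x) v) S"
  by simp

text \<open>Product and chain rules leave one factor undifferentiated; it has class
  \<open>Suc k\<close> and must be lowered to class \<open>k\<close> before an induction hypothesis
  applies.\<close>

lemma Ck_on_pred: "Ck_on (Suc k) f S \<Longrightarrow> Ck_on k f S"
proof (induction k arbitrary: f)
  case 0
  then show ?case
    by (auto intro!: continuous_at_imp_continuous_on differentiable_imp_continuous_within)
next
  case (Suc k)
  then show ?case by (auto simp del: Ck_on.simps(1))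
qed

lemma Ck_on_subset: "Ck_on k f S \<Longrightarrow> T \<subseteq> S \<Longrightarrow> Ck_on k f T"
  by (induction k arbitrary: f) (auto intro: continuous_on_subset)

lemma Ck_on_const: "Ck_on k (\<lambda>x. c) S"
  by (induction k arbitrary: c) auto

lemma Ck_on_bounded_linear:
  assumes "open S" "bounded_linear L" "Ck_on k f S"
  shows "Ck_on k (\<lambda>x. L (f x)) S"
  using assms(3)
proof (induction k arbitrary: f)
  case 0
  then show ?case using assms(2) by (auto intro: bounded_linear.continuous_on)
next
  case (Suc k)
  have "((\<lambda>x. L (f x)) has_derivative (\<lambda>v. L (frechet_derivative f (at x) v))) (at x)" if "x \<in> S" for x
    by (rule bounded_linear.has_derivative[OF assms(2) Ck_on_has_derivative[OF Suc.prems that]])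
  then show ?case
    by (rule Ck_on_SucI[OF assms(1)]) (use Suc assms(1) in auto)
qed

lemma Ck_on_add:
  assumes "open S" "Ck_on k f S" "Ck_on k g S"
  shows "Ck_on k (\<lambda>x. f x + g x) S"
  using assms(2,3)
proof (induction k arbitrary: f g)
  case 0
  then show ?case by (auto intro: continuous_intros)
next
  case (Suc k)
  have "((\<lambda>x. f x + g x) has_derivative
      (\<lambda>v. frechet_derivative f (at x) v + frechet_derivative g (at x) v)) (at x)" if "x \<in> S" for x
    by (intro has_derivative_add Ck_on_has_derivative[OF Suc.prems(1) that]
        Ck_on_has_derivative[OF Suc.prems(2) that])
  then show ?case
    by (rule Ck_on_SucI[OF assms(1)]) (use Suc assms(1) in auto)
qed

lemma Ck_on_bounded_bilinear:
  assumes "open S" "bounded_bilinear B" "Ck_on k f S" "Ck_on k g S"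
  shows "Ck_on k (\<lambda>x. B (f x) (g x)) S"
  using assms(3,4)
proof (induction k arbitrary: f g)
  case 0
  then show ?case using assms(2) by (auto intro: bounded_bilinear.continuous_on)
next
  case (Suc k)
  have "((\<lambda>x. B (f x) (g x)) has_derivative
      (\<lambda>v. B (f x) (frechet_derivative g (at x) v) + B (frechet_derivative f (at x) v) (g x))) (at x)"
    if "x \<in> S" for x
    by (intro bounded_bilinear.FDERIV[OF assms(2)] Ck_on_has_derivative[OF Suc.prems(1) that]
        Ck_on_has_derivative[OF Suc.prems(2) that])
  then show ?case
    by (rule Ck_on_SucI[OF assms(1)])
      (use Suc assms(1) Ck_on_pred[OF Suc.prems(1)] Ck_on_pred[OF Suc.prems(2)]
        in \<open>auto intro!: Ck_on_add\<close>)
qed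

text \<open>In dimension one the derivative of \<open>h\<close> is multiplication by its value at 1,
  so the derivative of the composite is a product of a derivative of \<open>f\<close> and a
  composite of the same kind. Hence the induction varies \<open>h\<close> and keeps
  \<open>f\<close>.\<close>

lemma Ck_on_compose_real:
  fixes h :: "real \<Rightarrow> real"
  assumes "open S" "Ck_on k h J" "Ck_on k f S" "f ` S \<subseteq> J"
  shows "Ck_on k (\<lambda>x. h (f x)) S"
  using assms(2,3)
proof (induction k arbitrary: h)
  case 0
  then show ?case using assms(4) by (auto intro: continuous_on_compose2)
next
  case (Suc k)
  let ?h = "\<lambda>y. frechet_derivative h (at y) 1"
  have "((\<lambda>x. h (f x)) has_derivative (\<lambda>v. frechet_derivative f (at x) v * ?h (f x))) (at x)"
    if "x \<in> S" for x
  proof -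
    have h: "(h has_derivative frechet_derivative h (at (f x))) (at (f x))"
      using Ck_on_has_derivative[OF Suc.prems(1)] assms(4) that by auto
    have "frechet_derivative h (at (f x)) t = t * ?h (f x)" for t
      using linear_cmul[OF has_derivative_linear[OF h], of t 1] by simp
    then have *: "(\<lambda>v. frechet_derivative h (at (f x)) (frechet_derivative f (at x) v)) =
        (\<lambda>v. frechet_derivative f (at x) v * ?h (f x))"
      by (intro ext)
    show ?thesis
      using has_derivative_compose[OF Ck_on_has_derivative[OF Suc.prems(2) that] h] unfolding * .
  qed
  moreover have "Ck_on k (\<lambda>x. frechet_derivative f (at x) v * ?h (f x)) S" for v
    by (rule Ck_on_bounded_bilinear[OF assms(1) bounded_bilinear_mult])
      (use Suc Ck_on_pred[OF Suc.prems(2)] in auto)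
  ultimately show ?case by (rule Ck_on_SucI[OF assms(1)]) (use assms(1) in auto)
qed

lemma Ck_on_real_SucI:
  fixes f :: "real \<Rightarrow> real"
  assumes "open S" "\<And>x. x \<in> S \<Longrightarrow> (f has_real_derivative f' x) (at x)" "Ck_on k f' S"
  shows "Ck_on (Suc k) f S"
proof (rule Ck_on_SucI[where f' = "\<lambda>x v. v *\<^sub>R f' x"])
  show "(f has_derivative (\<lambda>v. v *\<^sub>R f' x)) (at x)" if "x \<in> S" for x
    using assms(2)[OF that] by (simp add: has_field_derivative_def mult_commute_abs)
  show "Ck_on k (\<lambda>x. v *\<^sub>R f' x) S" for v
    by (rule Ck_on_bounded_linear[OF assms(1) bounded_linear_scaleR_right assms(3)])
qed (use assms(1) in auto)

section \<open>Closure properties of smooth functions\<close>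

lemma smooth_on_cong:
  "open S \<Longrightarrow> smooth_on f S \<Longrightarrow> (\<And>x. x \<in> S \<Longrightarrow> f x = g x) \<Longrightarrow> smooth_on g S"
  unfolding smooth_on_def using Ck_on_cong by blast

lemma smooth_on_subset: "smooth_on f S \<Longrightarrow> T \<subseteq> S \<Longrightarrow> smooth_on f T"
  unfolding smooth_on_def using Ck_on_subset by blast

lemma smooth_on_const: "smooth_on (\<lambda>x. c) S"
  unfolding smooth_on_def using Ck_on_const by blast

lemma smooth_on_bounded_linear:
  "open S \<Longrightarrow> bounded_linear L \<Longrightarrow> smooth_on f S \<Longrightarrow> smooth_on (\<lambda>x. L (f x)) S"
  unfolding smooth_on_def using Ck_on_bounded_linear by blast

lemma smooth_on_add:
  "open S \<Longrightarrow> smooth_on f S \<Longrightarrow> smooth_on g S \<Longrightarrow> smooth_on (\<lambda>x. f x + g x) S"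
  unfolding smooth_on_def using Ck_on_add by blast

lemma smooth_on_bounded_bilinear:
  "open S \<Longrightarrow> bounded_bilinear B \<Longrightarrow> smooth_on f S \<Longrightarrow> smooth_on g S
    \<Longrightarrow> smooth_on (\<lambda>x. B (f x) (g x)) S"
  unfolding smooth_on_def using Ck_on_bounded_bilinear by blast

lemmas smooth_on_mult = smooth_on_bounded_bilinear[OF _ bounded_bilinear_mult]

lemma smooth_on_minus: "open S \<Longrightarrow> smooth_on f S \<Longrightarrow> smooth_on (\<lambda>x. - f x) S"
  by (rule smooth_on_bounded_linear[OF _ bounded_linear_minus[OF bounded_linear_ident]])

lemma smooth_on_diff:
  "open S \<Longrightarrow> smooth_on f S \<Longrightarrow> smooth_on g S \<Longrightarrow> smooth_on (\<lambda>x. f x - g x) S"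
  using smooth_on_add[OF _ _ smooth_on_minus, of S f g] by simp

lemma smooth_on_compose_real:
  fixes h :: "real \<Rightarrow> real"
  shows "open S \<Longrightarrow> smooth_on h J \<Longrightarrow> smooth_on f S \<Longrightarrow> f ` S \<subseteq> J \<Longrightarrow> smooth_on (\<lambda>x. h (f x)) S"
  unfolding smooth_on_def using Ck_on_compose_real by blast

lemma smooth_on_SucI:
  assumes "open S" "\<And>x. x \<in> S \<Longrightarrow> (f has_derivative f' x) (at x)"
    "\<And>v. smooth_on (\<lambda>x. f' x v) S"
  shows "smooth_on f S"
  unfolding smooth_on_def
proof
  fix k
  have "Ck_on (Suc k) f S"
    by (rule Ck_on_SucI[OF assms(1,2)]) (use assms in \<open>auto simp: smooth_on_def\<close>)
  then show "Ck_on k f S" by (rule Ck_on_pred)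
qed

lemma smooth_on_real_derivI:
  fixes f :: "real \<Rightarrow> real"
  assumes "open S" "\<And>x. x \<in> S \<Longrightarrow> (f has_real_derivative f' x) (at x)" "smooth_on f' S"
  shows "smooth_on f S"
  unfolding smooth_on_def
  using Ck_on_pred[OF Ck_on_real_SucI[OF assms(1,2)]] assms(3) by (auto simp: smooth_on_def)

text \<open>Here, and likewise for \<open>inverse\<close> and \<open>sqrt\<close> on the positive
  half-line, the derivative is an expression in the function itself, so the induction hypothesis on
  \<open>k\<close> already covers it.\<close>

lemma smooth_on_exp: "smooth_on (exp :: real \<Rightarrow> real) UNIV"
  unfolding smooth_on_def
proof
  show "Ck_on k (exp :: real \<Rightarrow> real) UNIV" for k
    by (induction k)
      (auto intro!: continuous_intros simp del: Ck_on.simps(2) intro: Ck_on_real_SucI DERIV_exp)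
qed

lemma smooth_on_inverse: "smooth_on (inverse :: real \<Rightarrow> real) {0<..}"
  unfolding smooth_on_def
proof
  fix k show "Ck_on k (inverse :: real \<Rightarrow> real) {0<..}"
  proof (induction k)
    case (Suc k)
    have "Ck_on k (\<lambda>x::real. - (inverse x * inverse x)) {0<..}"
      by (intro Ck_on_bounded_linear[OF _ bounded_linear_minus[OF bounded_linear_ident]]
          Ck_on_bounded_bilinear[OF _ bounded_bilinear_mult] Suc) auto
    then show ?case
      by (rule Ck_on_real_SucI[rotated 2])
        (auto intro!: derivative_eq_intros simp: power2_eq_square)
  qed (auto intro!: continuous_intros)
qed

lemma smooth_on_sqrt: "smooth_on sqrt {0<..}"
  unfolding smooth_on_def
proof
  fix k show "Ck_on k sqrt {0<..}"
  proof (induction k)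
    case (Suc k)
    have "Ck_on k (\<lambda>x::real. (inverse (sqrt x)) / 2) {0<..}"
      by (rule Ck_on_bounded_linear[OF _ bounded_linear_divide
            Ck_on_compose_real[where J = "{0<..}" and h = inverse, OF _ _ Suc]])
        (use smooth_on_inverse in \<open>auto simp: smooth_on_def\<close>)
    then show ?case
      by (rule Ck_on_real_SucI[rotated 2]) (auto intro!: derivative_eq_intros)
  qed (auto intro!: continuous_intros)
qed

lemma smooth_on_divide:
  fixes f g :: "_ \<Rightarrow> real"
  assumes "open S" "smooth_on f S" "smooth_on g S" "\<And>x. x \<in> S \<Longrightarrow> g x > 0"
  shows "smooth_on (\<lambda>x. f x / g x) S"
  unfolding divide_inverse
  by (intro smooth_on_mult smooth_on_compose_real[OF _ smooth_on_inverse] assms) (use assms(4) in auto)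

lemma smooth_on_has_derivative:
  "smooth_on f S \<Longrightarrow> x \<in> S \<Longrightarrow> (f has_derivative frechet_derivative f (at x)) (at x)"
  unfolding smooth_on_def using Ck_on_has_derivative by blast

lemma smooth_on_frechet_derivative:
  "smooth_on f S \<Longrightarrow> smooth_on (\<lambda>x. frechet_derivative f (at x) v) S"
  unfolding smooth_on_def using Ck_on_frechet_derivative by blast

lemma smooth_on_vec:
  fixes f :: "'a::real_normed_vector \<Rightarrow> real^'n"
  assumes "open S" "\<And>i. smooth_on (\<lambda>x. f x $ i) S"
  shows "smooth_on f S"
proof -
  have fin: "smooth_on (\<lambda>x. \<Sum>i\<in>F. f x $ i *\<^sub>R (axis i 1 :: real^'n)) S" if "finite F" for F
    using that
    by (induction F) (auto intro!: smooth_on_const smooth_on_add assms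
        smooth_on_bounded_linear[OF _ bounded_linear_scaleR_left])
  have "(\<lambda>x. \<Sum>i\<in>UNIV. f x $ i *\<^sub>R (axis i 1 :: real^'n)) = f"
    unfolding scalar_mult_eq_scaleR[symmetric] by (simp add: basis_expansion)
  then show ?thesis using fin[of UNIV] by simp
qed

section \<open>Mean values along lines and symmetry of second derivatives\<close>

lemma has_real_derivative_along_line:
  fixes f :: "'a::real_normed_vector \<Rightarrow> real"
  assumes "f differentiable (at (c + s *\<^sub>R v))"
  shows "((\<lambda>t. f (c + t *\<^sub>R v)) has_real_derivative frechet_derivative f (at (c + s *\<^sub>R v)) v) (at s)"
proof -
  note d = assms[unfolded frechet_derivative_works]
  have "((\<lambda>t. c + t *\<^sub>R v) has_derivative (\<lambda>t. t *\<^sub>R v)) (at s)"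
    by (auto intro!: derivative_eq_intros)
  from has_derivative_compose[OF this d]
  have "((\<lambda>t. f (c + t *\<^sub>R v)) has_derivative (\<lambda>t. frechet_derivative f (at (c + s *\<^sub>R v)) (t *\<^sub>R v))) (at s)" .
  moreover have "frechet_derivative f (at (c + s *\<^sub>R v)) (t *\<^sub>R v) = frechet_derivative f (at (c + s *\<^sub>R v)) v * t" for t
    using linear_cmul[OF has_derivative_linear[OF d]] by simp
  ultimately show ?thesis by (simp add: has_field_derivative_def)
qed

text \<open>The alternating sum of \<open>f\<close> over the corners of a parallelogram is symmetric
  in \<open>v\<close> and \<open>w\<close>, yet equals h^2 times either mixed derivative at some
  point of the parallelogram; continuity forces the two to agree at \<open>p\<close>.\<close>

lemma symmetric_second_derivative:
  fixes f :: "'a::real_normed_vector \<Rightarrow> real"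
  assumes "open S" "Ck_on 2 f S" "p \<in> S"
  shows "frechet_derivative (\<lambda>q. frechet_derivative f (at q) v) (at p) w =
         frechet_derivative (\<lambda>q. frechet_derivative f (at q) w) (at p) v"
proof (rule ccontr)
  define D where "D f v q = frechet_derivative f (at q) v" for f :: "'a \<Rightarrow> real" and v q
  have C: "Ck_on (Suc (Suc 0)) f S" using assms(2) by (simp add: numeral_2_eq_2)
  have line: "((\<lambda>t. g (c + t *\<^sub>R v)) has_real_derivative D g v (c + s *\<^sub>R v)) (at s)"
    if "Ck_on (Suc k) g S" "c + s *\<^sub>R v \<in> S" for g c v s k
    unfolding D_def using that by (intro has_real_derivative_along_line) auto
  \<comment> \<open>the second difference quotient is a mixed derivative at an intermediate point\<close>
  have mixed: "\<exists>s t. 0 < s \<and> s < h \<and> 0 < t \<and> t < h \<and>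
      f (p + h *\<^sub>R v + h *\<^sub>R w) - f (p + h *\<^sub>R v) - f (p + h *\<^sub>R w) + f p
        = h * h * D (D f v) w (p + s *\<^sub>R v + t *\<^sub>R w)"
    if h: "h > 0" and in_S: "\<And>s t. 0 \<le> s \<Longrightarrow> s \<le> h \<Longrightarrow> 0 \<le> t \<Longrightarrow> t \<le> h \<Longrightarrow> p + s *\<^sub>R v + t *\<^sub>R w \<in> S"
    for v w h
  proof -
    \<comment> \<open>The mean value theorem along \<open>v\<close> is applied to the difference of
      \<open>f\<close> on two opposite edges; what results is a single difference along
      \<open>w\<close> of the derivative of \<open>f\<close>.\<close>
    have "\<exists>s. 0 < s \<and> s < h \<and>
       (f (p + h *\<^sub>R w + h *\<^sub>R v) - f (p + h *\<^sub>R v)) - (f (p + h *\<^sub>R w + 0 *\<^sub>R v) - f (p + 0 *\<^sub>R v))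
       = (h - 0) * (D f v (p + h *\<^sub>R w + s *\<^sub>R v) - D f v (p + s *\<^sub>R v))"
      by (rule MVT2[OF h, of "\<lambda>s. f (p + h *\<^sub>R w + s *\<^sub>R v) - f (p + s *\<^sub>R v)"])
        (intro derivative_intros line[OF C], use in_S[of _ h] in_S[of _ 0] h in \<open>auto simp: algebra_simps\<close>)
    then obtain s where s: "0 < s" "s < h" and s_eq:
       "f (p + h *\<^sub>R w + h *\<^sub>R v) - f (p + h *\<^sub>R v) - f (p + h *\<^sub>R w) + f p
       = h * (D f v (p + h *\<^sub>R w + s *\<^sub>R v) - D f v (p + s *\<^sub>R v))"
      by auto
    have C1: "Ck_on (Suc 0) (D f v) S"
      using Ck_on_frechet_derivative[OF C] unfolding D_def .
    have "\<exists>t. 0 < t \<and> t < h \<and>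
       D f v (p + s *\<^sub>R v + h *\<^sub>R w) - D f v (p + s *\<^sub>R v + 0 *\<^sub>R w)
       = (h - 0) * D (D f v) w (p + s *\<^sub>R v + t *\<^sub>R w)"
      by (rule MVT2[OF h]) (intro line[OF C1] in_S, use s in auto)
    then obtain t where "0 < t" "t < h"
       "D f v (p + s *\<^sub>R v + h *\<^sub>R w) - D f v (p + s *\<^sub>R v)
         = h * D (D f v) w (p + s *\<^sub>R v + t *\<^sub>R w)"
      by auto
    with s s_eq show ?thesis
      by (intro exI[of _ s] exI[of _ t]) (auto simp: algebra_simps)
  qed
  define a b where "a = D (D f v) w p" and "b = D (D f w) v p"
  \<comment> \<open>With half the gap as tolerance, no number can be within \<open>e\<close> of both
    \<open>a\<close> and \<open>b\<close>.\<close>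
  define e where "e = \<bar>a - b\<bar> / 2"
  assume "frechet_derivative (\<lambda>q. frechet_derivative f (at q) v) (at p) w \<noteq>
         frechet_derivative (\<lambda>q. frechet_derivative f (at q) w) (at p) v"
  then have "a \<noteq> b" by (simp add: a_def b_def D_def[abs_def])
  then have e: "e > 0" by (simp add: e_def)
  have cont: "continuous_on S (D (D f v) w)" for v w
    using C unfolding D_def[abs_def] by auto
  have near: "\<exists>d>0. \<forall>q. dist q p < d \<longrightarrow> q \<in> S \<and> \<bar>D (D f v) w q - D (D f v) w p\<bar> < e" for v w
  proof -
    obtain d1 where "d1 > 0" "\<forall>q\<in>S. dist q p < d1 \<longrightarrow> dist (D (D f v) w q) (D (D f v) w p) < e"
      using cont[of v w] assms(3) e unfolding continuous_on_iff by blast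
    moreover obtain d2 where "d2 > 0" "\<forall>q. dist q p < d2 \<longrightarrow> q \<in> S"
      using assms(1,3) unfolding open_dist by blast
    ultimately show ?thesis
      by (intro exI[of _ "min d1 d2"]) (auto simp: dist_real_def)
  qed
  obtain d1 where d1: "d1 > 0" "\<And>q. dist q p < d1 \<Longrightarrow> q \<in> S \<and> \<bar>D (D f v) w q - a\<bar> < e"
    using near[of v w] unfolding a_def by blast
  obtain d2 where d2: "d2 > 0" "\<And>q. dist q p < d2 \<Longrightarrow> q \<in> S \<and> \<bar>D (D f w) v q - b\<bar> < e"
    using near[of w v] unfolding b_def by blast
  \<comment> \<open>The summand 1 keeps \<open>m\<close> positive even when \<open>v\<close> and
    \<open>w\<close> vanish, and makes the estimate in \<open>close\<close> strict.\<close>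
  define m where "m = norm v + norm w + 1"
  define h where "h = min d1 d2 / m"
  have m: "m > 0" unfolding m_def by (auto intro: add_nonneg_pos)
  then have h: "h > 0" unfolding h_def using d1(1) d2(1) by simp
  have close: "dist (p + s *\<^sub>R v + t *\<^sub>R w) p < min d1 d2" if "0 \<le> s" "s \<le> h" "0 \<le> t" "t \<le> h" for s t
  proof -
    have "norm (s *\<^sub>R v + t *\<^sub>R w) \<le> s * norm v + t * norm w"
      using norm_triangle_ineq[of "s *\<^sub>R v" "t *\<^sub>R w"] that by simp
    also have "\<dots> \<le> h * norm v + h * norm w"
      using that by (intro add_mono mult_right_mono) auto
    also have "\<dots> < h * m" unfolding m_def using h by (simp add: algebra_simps)
    also have "\<dots> = min d1 d2" unfolding h_def using m by simp
    finally show ?thesis by (simp add: dist_norm add.assoc)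
  qed
  obtain s t where st: "0 < s" "s < h" "0 < t" "t < h"
      "f (p + h *\<^sub>R v + h *\<^sub>R w) - f (p + h *\<^sub>R v) - f (p + h *\<^sub>R w) + f p
        = h * h * D (D f v) w (p + s *\<^sub>R v + t *\<^sub>R w)"
    using mixed[OF h, of v w] close d1(2) by force
  have sw: "p + s *\<^sub>R w + t *\<^sub>R v = p + t *\<^sub>R v + s *\<^sub>R w" for s t by (simp add: algebra_simps)
  obtain s' t' where st': "0 < s'" "s' < h" "0 < t'" "t' < h"
      "f (p + h *\<^sub>R w + h *\<^sub>R v) - f (p + h *\<^sub>R w) - f (p + h *\<^sub>R v) + f p
        = h * h * D (D f w) v (p + s' *\<^sub>R w + t' *\<^sub>R v)"
    using mixed[OF h, of w v] close d1(2) sw by (metis min_less_iff_conj)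
  have "h * h * D (D f w) v (p + s' *\<^sub>R w + t' *\<^sub>R v) = h * h * D (D f v) w (p + s *\<^sub>R v + t *\<^sub>R w)"
    using st(5) st'(5)[unfolded sw[of h h]] by linarith
  then have "D (D f w) v (p + t' *\<^sub>R v + s' *\<^sub>R w) = D (D f v) w (p + s *\<^sub>R v + t *\<^sub>R w)"
    using h sw by simp
  moreover have "\<bar>D (D f v) w (p + s *\<^sub>R v + t *\<^sub>R w) - a\<bar> < e"
    using d1(2) close[of s t] st by auto
  moreover have "\<bar>D (D f w) v (p + t' *\<^sub>R v + s' *\<^sub>R w) - b\<bar> < e"
    using d2(2) close[of t' s'] st' by auto
  ultimately show False unfolding e_def by argo
qed

section \<open>Partial derivatives and intrinsic curvature\<close>

lemma pd_eq: "(f has_derivative D) (at p) \<Longrightarrow> pd i f p = D (axis i 1)"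
  unfolding pd_def using frechet_derivative_at by metis

lemma smooth_on_pd: "smooth_on f S \<Longrightarrow> smooth_on (pd i f) S"
  using smooth_on_frechet_derivative[of f S "axis i 1"] by (simp add: pd_def[abs_def])

lemma smooth_on_differentiable: "smooth_on f S \<Longrightarrow> x \<in> S \<Longrightarrow> f differentiable (at x)"
  using smooth_on_has_derivative differentiableI by blast

text \<open>The two functions have the same derivatives at \<open>p\<close>, so the choice in
  \<open>frechet_derivative\<close> picks the same map; this covers points where neither is
  differentiable.\<close>

lemma pd_cong:
  assumes "open S" "p \<in> S" "\<And>x. x \<in> S \<Longrightarrow> f x = g x"
  shows "pd i f p = pd i g p"
proof -
  have "(f has_derivative D) (at p) \<longleftrightarrow> (g has_derivative D) (at p)" for D
    using has_derivative_transform_within_open[OF _ assms(1,2), of f D UNIV g]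
      has_derivative_transform_within_open[OF _ assms(1,2), of g D UNIV f] assms(3) by auto
  then show ?thesis by (simp add: pd_def frechet_derivative_def)
qed

lemma vec2_expand: "(v::real^2) = v $ 1 *\<^sub>R axis 1 1 + v $ 2 *\<^sub>R axis 2 1"
  by (simp add: vec_eq_iff forall_2 axis_def)

lemma frechet_derivative_pd:
  assumes "f differentiable (at p)"
  shows "frechet_derivative f (at p) v = v $ 1 *\<^sub>R pd 1 f p + v $ 2 *\<^sub>R pd 2 f p"
proof -
  interpret linear "frechet_derivative f (at p)" by (rule linear_frechet_derivative[OF assms])
  show ?thesis
    by (subst vec2_expand[of v]) (simp only: add scale pd_def)
qed

lemma has_derivative_pd:
  assumes "f differentiable (at p)"
  shows "(f has_derivative (\<lambda>v. v $ 1 *\<^sub>R pd 1 f p + v $ 2 *\<^sub>R pd 2 f p)) (at p)"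
  using assms unfolding frechet_derivative_works frechet_derivative_pd[OF assms, abs_def] .

lemma pd_bounded_bilinear:
  assumes "bounded_bilinear B" "f differentiable (at p)" "g differentiable (at p)"
  shows "pd i (\<lambda>x. B (f x) (g x)) p = B (f p) (pd i g p) + B (pd i f p) (g p)"
  using pd_eq[OF bounded_bilinear.FDERIV[OF assms(1) assms(2,3)[unfolded frechet_derivative_works]]]
  by (simp add: pd_def)

lemmas pd_mult = pd_bounded_bilinear[OF bounded_bilinear_mult]

lemma pd_bounded_linear:
  assumes "bounded_linear L" "f differentiable (at p)"
  shows "pd i (\<lambda>x. L (f x)) p = L (pd i f p)"
  using pd_eq[OF bounded_linear.has_derivative[OF assms(1) assms(2)[unfolded frechet_derivative_works]]]
  by (simp add: pd_def)

lemmas pd_nth = pd_bounded_linear[OF bounded_linear_vec_nth]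

lemma pd_add:
  assumes "f differentiable (at p)" "g differentiable (at p)"
  shows "pd i (\<lambda>x. f x + g x) p = pd i f p + pd i g p"
  using pd_eq[OF has_derivative_add[OF assms[unfolded frechet_derivative_works]]]
  by (simp add: pd_def)

lemma pd_minus: "f differentiable (at p) \<Longrightarrow> pd i (\<lambda>x. - f x) p = - pd i f p"
  by (rule pd_bounded_linear[OF bounded_linear_minus[OF bounded_linear_ident]])

lemma pd_compose_real:
  assumes "(h has_real_derivative d) (at (f p))" "f differentiable (at p)"
  shows "pd i (\<lambda>x. h (f x)) p = d * pd i f p"
  using pd_eq[OF has_derivative_compose[OF assms(2)[unfolded frechet_derivative_works]
      assms(1)[unfolded has_field_derivative_def]]]
  by (simp add: pd_def)

lemma pd_commute:
  fixes f :: "real^2 \<Rightarrow> real"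
  assumes "open S" "Ck_on 2 f S" "p \<in> S"
  shows "pd i (pd j f) p = pd j (pd i f) p"
  using symmetric_second_derivative[OF assms] by (simp add: pd_def[abs_def])

lemma pd_commute_vec:
  fixes f :: "real^2 \<Rightarrow> real^'n"
  assumes "open S" "smooth_on f S" "p \<in> S"
  shows "pd i (pd j f) p = pd j (pd i f) p"
proof (subst vec_eq_iff, rule allI)
  fix k
  have nth: "pd i (pd j f) p $ k = pd i (pd j (\<lambda>q. f q $ k)) p" for i j
  proof -
    have "pd i (pd j f) p $ k = pd i (\<lambda>q. pd j f q $ k) p"
      by (rule pd_nth[symmetric]) (rule smooth_on_differentiable[OF smooth_on_pd[OF assms(2)] assms(3)])
    also have "\<dots> = pd i (pd j (\<lambda>q. f q $ k)) p"
      by (rule pd_cong[OF assms(1,3)]) (rule pd_nth[symmetric], rule smooth_on_differentiable[OF assms(2)])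
    finally show ?thesis .
  qed
  have "smooth_on (\<lambda>q. f q $ k) S"
    by (rule smooth_on_bounded_linear[OF assms(1) bounded_linear_vec_nth assms(2)])
  then show "pd i (pd j f) p $ k = pd j (pd i f) p $ k"
    unfolding nth by (intro pd_commute[OF assms(1) _ assms(3)]) (auto simp: smooth_on_def)
qed

section \<open>Gauss curvature from the second derivatives of an immersion\<close>

lemma matrix_inv_2:
  fixes A :: "real^2^2"
  assumes "det A \<noteq> 0"
  shows "matrix_inv A $ 1 $ 1 = A $ 2 $ 2 / det A" "matrix_inv A $ 1 $ 2 = - A $ 1 $ 2 / det A"
    "matrix_inv A $ 2 $ 1 = - A $ 2 $ 1 / det A" "matrix_inv A $ 2 $ 2 = A $ 1 $ 1 / det A"
proof -
  have "A ** matrix_inv A = mat 1"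
    using assms unfolding invertible_det_nz[symmetric] invertible_def matrix_inv_def
    by (rule someI2_ex) simp
  then have eq: "A$1$1 * matrix_inv A$1$1 + A$1$2 * matrix_inv A$2$1 = 1"
    "A$1$1 * matrix_inv A$1$2 + A$1$2 * matrix_inv A$2$2 = 0"
    "A$2$1 * matrix_inv A$1$1 + A$2$2 * matrix_inv A$2$1 = 0"
    "A$2$1 * matrix_inv A$1$2 + A$2$2 * matrix_inv A$2$2 = 1"
    by (auto simp: vec_eq_iff forall_2 matrix_matrix_mult_def sum_2 mat_def)
  have "matrix_inv A $ 1 $ 1 * det A = A $ 2 $ 2" "matrix_inv A $ 1 $ 2 * det A = - A $ 1 $ 2"
    "matrix_inv A $ 2 $ 1 * det A = - A $ 2 $ 1" "matrix_inv A $ 2 $ 2 * det A = A $ 1 $ 1"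
    unfolding det_2 using eq by algebra+
  then show "matrix_inv A $ 1 $ 1 = A $ 2 $ 2 / det A" "matrix_inv A $ 1 $ 2 = - A $ 1 $ 2 / det A"
    "matrix_inv A $ 2 $ 1 = - A $ 2 $ 1 / det A" "matrix_inv A $ 2 $ 2 = A $ 1 $ 1 / det A"
    using assms by (auto simp: field_simps)
qed

text \<open>Raising an index and lowering it again is the identity. The left sides have exactly the
  shape that \<open>matrix_inv_2\<close> produces, so that they can be used as rewrite
  rules.\<close>

lemma cramer_2:
  fixes a b c d x y :: real
  assumes "D = a * d - b * c" "D \<noteq> 0"
  shows "a * (d / D * x + - b / D * y) + b * (- c / D * x + a / D * y) = x"
    and "c * (d / D * x + - b / D * y) + d * (- c / D * x + a / D * y) = y"
proof -
  have "a * (d / D * x + - b / D * y) + b * (- c / D * x + a / D * y) = (a * d - b * c) * x / D"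
    "c * (d / D * x + - b / D * y) + d * (- c / D * x + a / D * y) = (a * d - b * c) * y / D"
    by (simp_all add: add_divide_distrib diff_divide_distrib algebra_simps)
  then show "a * (d / D * x + - b / D * y) + b * (- c / D * x + a / D * y) = x"
    and "c * (d / D * x + - b / D * y) + d * (- c / D * x + a / D * y) = y"
    unfolding assms(1)[symmetric] using assms(2) by simp_all
qed

text \<open>The inverse metric resists differentiation, so the Christoffel symbols are
  differentiated only after lowering the index, where they equal \<open>B\<close> of a second
  derivative with a coordinate field. The third derivatives of \<open>X\<close> cancel. The double
  sum is the contribution of the tangential parts of the second derivatives, so the right side is
  the determinant of the normal-valued second fundamental form.\<close>

lemma gauss_curvature_induced_metric:
  fixes X :: "real^2 \<Rightarrow> real^3" and B :: "real^3 \<Rightarrow> real^3 \<Rightarrow> real"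
  assumes S: "open S" "p \<in> S" and X: "smooth_on X S"
    and B: "bounded_bilinear B" and sym: "\<And>v w. B v w = B w v"
    and nondeg: "\<And>q. q \<in> S \<Longrightarrow> det (induced_metric B X q) \<noteq> 0"
  shows "det (induced_metric B X p) * gauss_curvature (induced_metric B X) p =
    B (pd 1 (pd 1 X) p) (pd 2 (pd 2 X) p) - B (pd 1 (pd 2 X) p) (pd 1 (pd 2 X) p)
    - (\<Sum>k\<in>UNIV. \<Sum>l\<in>UNIV. matrix_inv (induced_metric B X p) $ k $ l *
        (B (pd 2 (pd 2 X) p) (pd l X p) * B (pd 1 (pd 1 X) p) (pd k X p)
         - B (pd 1 (pd 2 X) p) (pd l X p) * B (pd 1 (pd 2 X) p) (pd k X p)))"
proof -
  define G where "G = induced_metric B X"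
  define H where "H i j = pd i (pd j X)" for i j
  have G: "G q $ i $ j = B (pd i X q) (pd j X q)" for q i j
    by (simp add: G_def induced_metric_def)
  have nondegG: "det (G q) \<noteq> 0" if "q \<in> S" for q using nondeg[OF that] by (simp add: G_def)
  have diff1: "pd i X differentiable (at q)" if "q \<in> S" for i q
    by (intro smooth_on_differentiable[OF _ that] smooth_on_pd X)
  have diff2: "H i j differentiable (at q)" if "q \<in> S" for i j q
    unfolding H_def by (intro smooth_on_differentiable[OF _ that] smooth_on_pd X)
  have Hsym: "H i j q = H j i q" if "q \<in> S" for i j q
    unfolding H_def by (rule pd_commute_vec[OF S(1) X that])
  have diffB: "(\<lambda>q. B (f q) (g q)) differentiable (at q)"
    if "f differentiable (at q)" "g differentiable (at q)" for f g :: "real^2 \<Rightarrow> real^3" and q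
    using bounded_bilinear.FDERIV[OF B] that unfolding differentiable_def by blast
  have diffG: "(\<lambda>q. G q $ i $ j) differentiable (at q)" if "q \<in> S" for i j q
    unfolding G using diffB diff1[OF that] by blast
  have dG: "pd k (\<lambda>q. G q $ i $ j) q = B (H k i q) (pd j X q) + B (pd i X q) (H k j q)"
    if "q \<in> S" for k i j q
    unfolding G H_def using pd_bounded_bilinear[OF B diff1[OF that] diff1[OF that]] by simp
  have chr: "christoffel G k i j q = (\<Sum>l\<in>UNIV. matrix_inv (G q) $ k $ l * B (H i j q) (pd l X q))"
    if "q \<in> S" for k i j q
  proof -
    \<comment> \<open>The product rule gives six terms; four cancel by symmetry of \<open>B\<close>
      and of the second partial derivatives.\<close>
    have "pd i (\<lambda>q. G q $ j $ l) q + pd j (\<lambda>q. G q $ i $ l) q - pd l (\<lambda>q. G q $ i $ j) q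
        = 2 * B (H i j q) (pd l X q)" for l
      unfolding dG[OF that]
      using Hsym[OF that, of i j] Hsym[OF that, of i l] Hsym[OF that, of j l]
        sym[of "pd j X q" "H i l q"] by simp
    then show ?thesis by (simp add: christoffel_def sum_2)
  qed
  have lower: "G q $ m $ 1 * christoffel G 1 i j q + G q $ m $ 2 * christoffel G 2 i j q
      = B (H i j q) (pd m X q)" if "q \<in> S" for m i j q
  proof -
    note D = det_2[of "G q"] nondegG[OF that]
    consider "m = 1" | "m = 2" using exhaust_2[of m] by auto
    then show ?thesis
      unfolding chr[OF that] sum_2 matrix_inv_2[OF nondegG[OF that]]
      by cases (simp_all only: cramer_2[OF D])
  qed
  \<comment> \<open>No derivative of \<open>matrix_inv\<close> is evaluated: this secures the
    existence of the derivatives, which the product rule in \<open>dlower\<close>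
    presupposes.\<close>
  have diffC: "christoffel G k i j differentiable (at p)" for k i j
  proof -
    have detd: "(\<lambda>q. det (G q)) differentiable (at p)"
      unfolding det_2 by (intro differentiable_diff differentiable_mult diffG S)
    have inv: "(\<lambda>q. matrix_inv (G q) $ k $ l) differentiable (at p)" for l
    proof -
      have d: "(\<lambda>q. G q $ a $ b / det (G q)) differentiable (at p)"
        "(\<lambda>q. - G q $ a $ b / det (G q)) differentiable (at p)" for a b
        by (intro differentiable_divide differentiable_minus diffG detd nondegG S)+
      have t: "f differentiable (at p) \<Longrightarrow> (\<And>q. q \<in> S \<Longrightarrow> f q = g q) \<Longrightarrow> g differentiable (at p)"
        for f g :: "real^2 \<Rightarrow> real"
        unfolding differentiable_def
        using has_derivative_transform_within_open[OF _ S(1,2), of f _ UNIV g] by auto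
      show ?thesis
        using exhaust_2[of k] exhaust_2[of l] by (auto intro: t[OF d(1)] t[OF d(2)] simp: matrix_inv_2 nondegG)
    qed
    have "(\<lambda>q. \<Sum>l\<in>UNIV. matrix_inv (G q) $ k $ l * B (H i j q) (pd l X q)) differentiable (at p)"
      unfolding sum_2
      by (intro differentiable_add differentiable_mult inv diffB diff1 diff2 S)
    then show ?thesis
      unfolding differentiable_def
      using has_derivative_transform_within_open[OF _ S(1,2), of _ _ UNIV "christoffel G k i j"] chr by auto
  qed
  define C where "C k i j = christoffel G k i j p" for k i j
  define dC where "dC m k i j = pd m (christoffel G k i j) p" for m k i j
  define h where "h i j m = B (H i j p) (pd m X p)" for i j m
  define g where "g i j = G p $ i $ j" for i j
  \<comment> \<open>The product rule on \<open>lower\<close> is solved for the differentiated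
    Christoffel symbols. The row \<open>m = 1\<close> is the one that \<open>gauss_curvature\<close>
    contracts with.\<close>
  have dlower: "g 1 1 * dC a 1 i j + g 1 2 * dC a 2 i j =
      B (pd a (H i j) p) (pd 1 X p) + B (H i j p) (H a 1 p)
      - (h a 1 1 + h a 1 1) * C 1 i j - (h a 1 2 + h a 2 1) * C 2 i j" for a i j
  proof -
    have "pd a (\<lambda>q. G q $ 1 $ 1 * christoffel G 1 i j q + G q $ 1 $ 2 * christoffel G 2 i j q) p
       = pd a (\<lambda>q. B (H i j q) (pd 1 X q)) p"
      using lower by (intro pd_cong[OF S])
    moreover have "pd a (\<lambda>q. B (H i j q) (pd 1 X q)) p = B (H i j p) (H a 1 p) + B (pd a (H i j) p) (pd 1 X p)"
      using pd_bounded_bilinear[OF B diff2 diff1, OF S(2) S(2)] by (simp add: H_def)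
    moreover have "pd a (\<lambda>q. G q $ 1 $ 1 * christoffel G 1 i j q + G q $ 1 $ 2 * christoffel G 2 i j q) p
       = g 1 1 * dC a 1 i j + (h a 1 1 + h a 1 1) * C 1 i j
         + (g 1 2 * dC a 2 i j + (h a 1 2 + h a 2 1) * C 2 i j)"
      by (simp add: pd_add pd_mult diffG diffC S dG g_def dC_def C_def h_def
          sym[of "pd _ X p" "H _ _ p"])
    ultimately show ?thesis by simp
  qed
  have low: "g 1 1 * C 1 i j + g 1 2 * C 2 i j = h i j 1" for i j
    using lower[OF S(2), of 1 i j] by (simp add: g_def C_def h_def)
  have gsym: "g 2 1 = g 1 2" by (simp add: g_def G sym)
  have hsym: "h 2 1 = h 1 2" "H 2 1 p = H 1 2 p" using Hsym[OF S(2), of 2 1] by (auto simp: h_def)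
  \<comment> \<open>Commuting partial derivatives of \<open>pd 2 X\<close> identifies the two third
    derivatives that occur, which then cancel.\<close>
  have third: "pd 2 (H 1 2) p = pd 1 (H 2 2) p"
    unfolding H_def by (rule pd_commute_vec[OF S(1) smooth_on_pd[OF X] S(2)])
  have "det (G p) * gauss_curvature G p = (\<Sum>l\<in>UNIV. g l 1 * riemann G l 1 2 2 p)"
    using nondegG[OF S(2)] by (simp add: gauss_curvature_def g_def)
  also have "\<dots> = (g 1 1 * dC 1 1 2 2 + g 1 2 * dC 1 2 2 2) - (g 1 1 * dC 2 1 1 2 + g 1 2 * dC 2 2 1 2)
     + (g 1 1 * C 1 1 1 + g 1 2 * C 2 1 1) * C 1 2 2 + (g 1 1 * C 1 1 2 + g 1 2 * C 2 1 2) * C 2 2 2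
     - (g 1 1 * C 1 2 1 + g 1 2 * C 2 2 1) * C 1 1 2 - (g 1 1 * C 1 2 2 + g 1 2 * C 2 2 2) * C 2 1 2"
    unfolding sum_2 riemann_def gsym C_def[symmetric] dC_def[symmetric] by (simp add: algebra_simps)
  also have "\<dots> = B (H 2 2 p) (H 1 1 p) - B (H 1 2 p) (H 1 2 p)
     - (h 1 1 1 * C 1 2 2 + h 1 1 2 * C 2 2 2) + (h 1 2 1 * C 1 1 2 + h 1 2 2 * C 2 1 2)"
    unfolding low dlower third hsym by (simp add: algebra_simps hsym)
  also have "\<dots> = B (H 1 1 p) (H 2 2 p) - B (H 1 2 p) (H 1 2 p)
      - (\<Sum>k\<in>UNIV. \<Sum>l\<in>UNIV. matrix_inv (G p) $ k $ l * (h 2 2 l * h 1 1 k - h 1 2 l * h 1 2 k))"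
    unfolding C_def chr[OF S(2)] sum_2 h_def[symmetric] sym[of "H 2 2 p"] by (simp add: algebra_simps)
  finally show ?thesis unfolding G_def H_def h_def .
qed

section \<open>Inverse maps and injective gradients\<close>

text \<open>Invariance of domain makes the image open and the inverse K continuous, and then K has
  derivative \<open>M\<close>. For smoothness the induction runs over all smooth \<open>g\<close> at
  once: the derivative of g composed with K along \<open>v\<close> is again a function composed with
  K, and \<open>M_smooth\<close> says that this function is smooth.\<close>

lemma smooth_on_compose_inv_into:
  fixes L :: "'a::euclidean_space \<Rightarrow> 'a" and g :: "'a \<Rightarrow> real"
  assumes S: "open S" "inj_on L S"
    and L: "\<And>x. x \<in> S \<Longrightarrow> (L has_derivative L' x) (at x)"
    and M: "\<And>x. x \<in> S \<Longrightarrow> bounded_linear (M x)" "\<And>x. x \<in> S \<Longrightarrow> M x \<circ> L' x = id"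
    and M_smooth: "\<And>(f::'a \<Rightarrow> real) v. smooth_on f S \<Longrightarrow>
      smooth_on (\<lambda>x. frechet_derivative f (at x) (M x v)) S"
    and g: "smooth_on g S"
  shows "open (L ` S)" "smooth_on (\<lambda>y. g (inv_into S L y)) (L ` S)"
proof -
  have contL: "continuous_on S L"
    using L by (intro continuous_at_imp_continuous_on) (auto intro: has_derivative_continuous)
  show op: "open (L ` S)" by (rule invariance_of_domain[OF contL S])
  let ?K = "inv_into S L"
  have contK: "continuous_on (L ` S) ?K"
    using S(2) by (intro continuous_on_inverse_open[OF S(1) contL]) auto
  have K: "(?K has_derivative M (?K y)) (at y)" if y: "y \<in> L ` S" for y
  proof -
    have "?K y \<in> S" "L (?K y) = y" using inv_into_into[OF y] f_inv_into_f[OF y] by auto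
    then show ?thesis
      using has_derivative_inverse_dieudonne[OF S(1) op contL contK _ _ L M, of "?K y"] S(2) by simp
  qed
  show "smooth_on (\<lambda>y. g (?K y)) (L ` S)"
    unfolding smooth_on_def
  proof
    show "Ck_on k (\<lambda>y. g (?K y)) (L ` S)" for k
      using g
    proof (induction k arbitrary: g)
      case 0
      then have "continuous_on S g" unfolding smooth_on_def by (metis Ck_on.simps(1))
      then show ?case
        using contK by (auto intro!: continuous_on_compose2[of S g] inv_into_into)
    next
      case (Suc k)
      have "((\<lambda>y. g (?K y)) has_derivative
          (\<lambda>v. frechet_derivative g (at (?K y)) (M (?K y) v))) (at y)" if "y \<in> L ` S" for y
        by (rule has_derivative_compose[OF K[OF that] smooth_on_has_derivative[OF Suc.prems inv_into_into[OF that]]])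
      then show ?case
        by (rule Ck_on_SucI[OF op _ Suc.IH[OF M_smooth[OF Suc.prems]]])
    qed
  qed
qed

text \<open>On the segment from \<open>p\<close> to \<open>q\<close>, which stays in
  \<open>U\<close>, the derivative of \<open>f\<close> along \<open>q - p\<close> is strictly
  increasing, so the gradients at the two ends differ.\<close>

lemma inj_on_gradient_convex:
  fixes f :: "real^2 \<Rightarrow> real"
  assumes diff: "\<And>x. x \<in> U \<Longrightarrow> pd 1 f differentiable (at x)" "\<And>x. x \<in> U \<Longrightarrow> pd 2 f differentiable (at x)"
    and pos: "\<And>x v. x \<in> U \<Longrightarrow> v \<noteq> 0 \<Longrightarrow>
      v $ 1 * frechet_derivative (pd 1 f) (at x) v + v $ 2 * frechet_derivative (pd 2 f) (at x) v > 0"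
    and "convex U"
  shows "inj_on (legendre_map f) U"
proof (rule inj_onI, rule ccontr)
  fix p q assume pq: "p \<in> U" "q \<in> U" "legendre_map f p = legendre_map f q" "p \<noteq> q"
  define v where "v = q - p"
  define m where "m t = v $ 1 * pd 1 f (p + t *\<^sub>R v) + v $ 2 * pd 2 f (p + t *\<^sub>R v)" for t
  have in_U: "p + t *\<^sub>R v \<in> U" if "0 \<le> t" "t \<le> 1" for t
    using convexD_alt[OF \<open>convex U\<close> pq(1,2) that] by (simp add: v_def algebra_simps)
  have "\<exists>t. 0 < t \<and> t < 1 \<and> m 1 - m 0 = (1 - 0) *
      (v $ 1 * frechet_derivative (pd 1 f) (at (p + t *\<^sub>R v)) v
       + v $ 2 * frechet_derivative (pd 2 f) (at (p + t *\<^sub>R v)) v)"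
    unfolding m_def
    by (rule MVT2) (auto intro!: DERIV_add DERIV_cmult has_real_derivative_along_line diff in_U)
  moreover have "v \<noteq> 0" using pq(4) by (simp add: v_def)
  ultimately have "m 1 - m 0 > 0"
    using pos[OF in_U \<open>v \<noteq> 0\<close>] by (metis diff_zero less_le mult_1)
  moreover have "m 1 = m 0"
    using pq(3) by (simp add: m_def v_def legendre_map_def vec_eq_iff forall_2)
  ultimately show False by simp
qed

text \<open>In a non-convex \<open>U\<close> the segment along \<open>v\<close> may leave
  \<open>U\<close>, so strict convexity is available only on a short initial piece. One such point
  suffices below, since a convex extension carries the strict inequality on to the far end.\<close>

lemma above_tangent_plane:
  fixes f :: "real^2 \<Rightarrow> real"
  assumes U: "open U" "p \<in> U" and diff0: "\<And>x. x \<in> U \<Longrightarrow> f differentiable (at x)"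
    and diff: "\<And>x. x \<in> U \<Longrightarrow> pd 1 f differentiable (at x)" "\<And>x. x \<in> U \<Longrightarrow> pd 2 f differentiable (at x)"
    and pos: "\<And>x v. x \<in> U \<Longrightarrow> v \<noteq> 0 \<Longrightarrow>
      v $ 1 * frechet_derivative (pd 1 f) (at x) v + v $ 2 * frechet_derivative (pd 2 f) (at x) v > 0"
    and "v \<noteq> 0"
  shows "\<exists>t. 0 < t \<and> t \<le> 1 \<and> p + t *\<^sub>R v \<in> U \<and>
    f (p + t *\<^sub>R v) > f p + t * (v $ 1 * pd 1 f p + v $ 2 * pd 2 f p)"
proof -
  define m where "m t = v $ 1 * pd 1 f (p + t *\<^sub>R v) + v $ 2 * pd 2 f (p + t *\<^sub>R v)" for t
  obtain d where d: "d > 0" "ball p d \<subseteq> U" using U open_contains_ball by blast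
  \<comment> \<open>The factor 2 keeps the segment strictly inside the ball; the bound 1 makes
    \<open>h\<close> usable as a weight in a convex combination.\<close>
  define h where "h = min 1 (d / (2 * norm v))"
  have h: "h > 0" "h \<le> 1" using d \<open>v \<noteq> 0\<close> by (auto simp: h_def)
  have "h * norm v \<le> d / (2 * norm v) * norm v"
    unfolding h_def by (intro mult_right_mono) auto
  then have hv: "h * norm v < d" using d(1) \<open>v \<noteq> 0\<close> by simp
  have in_U: "p + t *\<^sub>R v \<in> U" if "0 \<le> t" "t \<le> h" for t
  proof -
    have "t * norm v \<le> h * norm v" using that by (intro mult_right_mono) auto
    then have "p + t *\<^sub>R v \<in> ball p d" using that hv by (simp add: dist_norm)
    then show ?thesis using d(2) by auto
  qed
  have "\<exists>t. 0 < t \<and> t < h \<and> f (p + h *\<^sub>R v) - f (p + 0 *\<^sub>R v)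
      = (h - 0) * frechet_derivative f (at (p + t *\<^sub>R v)) v"
    by (rule MVT2[OF h(1)]) (auto intro!: has_real_derivative_along_line diff0 in_U)
  then obtain t where t: "0 < t" "t < h" "f (p + h *\<^sub>R v) - f p = h * m t"
    using frechet_derivative_pd[OF diff0[OF in_U], of _ v] by (auto simp: m_def)
  have "\<exists>s. 0 < s \<and> s < t \<and> m t - m 0 = (t - 0) *
      (v $ 1 * frechet_derivative (pd 1 f) (at (p + s *\<^sub>R v)) v
       + v $ 2 * frechet_derivative (pd 2 f) (at (p + s *\<^sub>R v)) v)"
    unfolding m_def using t
    by (intro MVT2) (auto intro!: DERIV_add DERIV_cmult has_real_derivative_along_line diff in_U)
  then have "m t > m 0"
    using pos[OF in_U \<open>v \<noteq> 0\<close>] t by (smt (verit) mult_pos_pos)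
  then have "h * m t > h * m 0" using h by simp
  with t(3) have "f (p + h *\<^sub>R v) > f p + h * m 0" by linarith
  then show ?thesis
    using h in_U[of h] by (intro exI[of _ h]) (simp add: m_def)
qed

text \<open>The graph of \<open>f\<close> lies strictly above each tangent plane away from the point
  of contact. If two points had the same gradient, adding the inequality from \<open>p\<close> to
  \<open>q\<close> and the one from \<open>q\<close> to \<open>p\<close> would give 0 < 0.\<close>

lemma inj_on_gradient_convex_function:
  fixes f :: "real^2 \<Rightarrow> real"
  assumes U: "open U" and diff0: "\<And>x. x \<in> U \<Longrightarrow> f differentiable (at x)"
    and diff: "\<And>x. x \<in> U \<Longrightarrow> pd 1 f differentiable (at x)" "\<And>x. x \<in> U \<Longrightarrow> pd 2 f differentiable (at x)"
    and pos: "\<And>x v. x \<in> U \<Longrightarrow> v \<noteq> 0 \<Longrightarrow>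
      v $ 1 * frechet_derivative (pd 1 f) (at x) v + v $ 2 * frechet_derivative (pd 2 f) (at x) v > 0"
    and "convex_function_on U f"
  shows "inj_on (legendre_map f) U"
proof (rule inj_onI, rule ccontr)
  obtain F where F: "convex_on (convex hull U) F" "\<And>p. p \<in> U \<Longrightarrow> F p = f p"
    using assms(6) unfolding convex_function_on_def by blast
  have strict: "f q - f p > (q - p) $ 1 * pd 1 f p + (q - p) $ 2 * pd 2 f p"
    if pq: "p \<in> U" "q \<in> U" "p \<noteq> q" for p q
  proof -
    have "q - p \<noteq> 0" using pq by simp
    from above_tangent_plane[OF U pq(1) diff0 diff pos this]
    obtain t where t: "0 < t" "t \<le> 1" "p + t *\<^sub>R (q - p) \<in> U"
      "f (p + t *\<^sub>R (q - p)) > f p + t * ((q - p) $ 1 * pd 1 f p + (q - p) $ 2 * pd 2 f p)"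
      by blast
    have "F ((1 - t) *\<^sub>R p + t *\<^sub>R q) \<le> (1 - t) * F p + t * F q"
      using convex_onD[OF F(1), of t p q] t pq hull_inc[of _ U] by auto
    moreover have "(1 - t) *\<^sub>R p + t *\<^sub>R q = p + t *\<^sub>R (q - p)" by (simp add: algebra_simps)
    ultimately have "f (p + t *\<^sub>R (q - p)) \<le> f p + t * (f q - f p)"
      using t F(2) pq by (simp add: algebra_simps)
    with t have "t * ((q - p) $ 1 * pd 1 f p + (q - p) $ 2 * pd 2 f p) < t * (f q - f p)" by linarith
    then show ?thesis using t(1) by (simp only: mult_less_cancel_left_pos)
  qed
  fix p q assume pq: "p \<in> U" "q \<in> U" "legendre_map f p = legendre_map f q" "p \<noteq> q"
  then have "pd 1 f p = pd 1 f q" "pd 2 f p = pd 2 f q"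
    by (auto simp: legendre_map_def vec_eq_iff forall_2)
  then show False using strict[OF pq(1,2,4)] strict[OF pq(2,1)] pq(4) by (simp add: algebra_simps)
qed

section \<open>Surfaces in three-space\<close>

lemma bounded_bilinear_lorentz: "bounded_bilinear lorentz"
  unfolding bilinear_conv_bounded_bilinear[symmetric] bilinear_def lorentz_def
  by (auto intro!: linearI simp: algebra_simps)

lemma lorentz_commute: "lorentz v w = lorentz w v"
  by (simp add: lorentz_def)

lemma vec_eq_3: "(v::'a^3) = w \<longleftrightarrow> v $ 1 = w $ 1 \<and> v $ 2 = w $ 2 \<and> v $ 3 = w $ 3"
  by (simp add: vec_eq_iff forall_3)

lemma vec_eq_2: "(v::'a^2) = w \<longleftrightarrow> v $ 1 = w $ 1 \<and> v $ 2 = w $ 2"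
  by (simp add: vec_eq_iff forall_2)

lemma inner_3: "(v::real^3) \<bullet> w = v $ 1 * w $ 1 + v $ 2 * w $ 2 + v $ 3 * w $ 3"
  by (simp add: inner_vec_def sum_3)

lemma smooth_on_vector_3:
  fixes f g h :: "'a::real_normed_vector \<Rightarrow> real"
  assumes "open S" "smooth_on f S" "smooth_on g S" "smooth_on h S"
  shows "smooth_on (\<lambda>x. vector [f x, g x, h x] :: real^3) S"
proof (rule smooth_on_vec[OF assms(1)])
  show "smooth_on (\<lambda>x. (vector [f x, g x, h x] :: real^3) $ i) S" for i
    using exhaust_3[of i] assms by auto
qed

lemma smooth_on_vector_2:
  fixes f g :: "'a::real_normed_vector \<Rightarrow> real"
  assumes "open S" "smooth_on f S" "smooth_on g S"
  shows "smooth_on (\<lambda>x. vector [f x, g x] :: real^2) S"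
proof (rule smooth_on_vec[OF assms(1)])
  show "smooth_on (\<lambda>x. (vector [f x, g x] :: real^2) $ i) S" for i
    using exhaust_2[of i] assms by auto
qed

lemma induced_metric_nth: "induced_metric B X p $ i $ j = B (pd i X p) (pd j X p)"
  by (simp add: induced_metric_def)

text \<open>Orthogonality to both coordinate fields is a linear system for \<open>s1\<close>,
  \<open>s2\<close> with the metric as its matrix. This replaces positivity, as \<open>B\<close> may
  be indefinite, and yields both the injectivity of the differential and the uniqueness of normal
  parts.\<close>

lemma tangent_eq_0:
  fixes X :: "real^2 \<Rightarrow> real^3"
  assumes B: "bounded_bilinear B" and nondeg: "det (induced_metric B X p) \<noteq> 0"
    and t: "t = s1 *\<^sub>R pd 1 X p + s2 *\<^sub>R pd 2 X p" "B t (pd 1 X p) = 0" "B t (pd 2 X p) = 0"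
  shows "s1 = 0 \<and> s2 = 0"
proof -
  interpret bounded_bilinear B by (rule B)
  define G where "G = induced_metric B X p"
  have "s1 * G $ 1 $ 1 + s2 * G $ 2 $ 1 = 0" "s1 * G $ 1 $ 2 + s2 * G $ 2 $ 2 = 0"
    using t by (simp_all add: G_def induced_metric_nth add_left scaleR_left)
  then have "s1 * det G = 0" "s2 * det G = 0" unfolding det_2 by algebra+
  then show ?thesis using nondeg by (simp add: G_def)
qed

lemma inj_frechet_derivative_of_nondegenerate:
  fixes X :: "real^2 \<Rightarrow> real^3"
  assumes B: "bounded_bilinear B" and X: "X differentiable (at p)"
    and nondeg: "det (induced_metric B X p) \<noteq> 0"
  shows "inj (frechet_derivative X (at p))"
proof -
  interpret bounded_bilinear B by (rule B)
  have "v = 0" if "frechet_derivative X (at p) v = 0" for v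
    using tangent_eq_0[OF B nondeg, of 0 "v $ 1" "v $ 2"] that
    by (simp add: frechet_derivative_pd[OF X] zero_left vec_eq_2)
  then show ?thesis using linear_injective_0[OF linear_frechet_derivative[OF X]] by blast
qed

text \<open>The difference of two candidates is tangent and orthogonal to the tangent plane, hence
  zero. A normal projection is thus computed by exhibiting a decomposition.\<close>

lemma normal_part_eq:
  fixes X :: "real^2 \<Rightarrow> real^3"
  assumes B: "bounded_bilinear B" and X: "X differentiable (at p)"
    and nondeg: "det (induced_metric B X p) \<noteq> 0"
    and w: "w = n + c1 *\<^sub>R pd 1 X p + c2 *\<^sub>R pd 2 X p"
    and n: "B n (pd 1 X p) = 0" "B n (pd 2 X p) = 0"
  shows "normal_part B X p w = n"
  unfolding normal_part_def
proof (rule the_equality)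
  interpret bounded_bilinear B by (rule B)
  let ?D = "frechet_derivative X (at p)"
  have tangent: "c *\<^sub>R pd 1 X p + d *\<^sub>R pd 2 X p \<in> range ?D" for c d
    using rangeI[of ?D "vector [c, d]"] by (simp add: frechet_derivative_pd[OF X])
  show "w - n \<in> range ?D \<and> (\<forall>t\<in>range ?D. B n t = 0)"
    using tangent[of c1 c2] w n
    by (auto simp: frechet_derivative_pd[OF X] add_right scaleR_right)
  fix m assume m: "w - m \<in> range ?D \<and> (\<forall>t\<in>range ?D. B m t = 0)"
  then obtain v :: "real^2" where "w - m = v $ 1 *\<^sub>R pd 1 X p + v $ 2 *\<^sub>R pd 2 X p"
    by (auto simp: frechet_derivative_pd[OF X])
  then have d: "m - n = (c1 - v $ 1) *\<^sub>R pd 1 X p + (c2 - v $ 2) *\<^sub>R pd 2 X p"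
    unfolding w by (simp add: algebra_simps)
  have "B m (pd 1 X p) = 0" "B m (pd 2 X p) = 0"
    using m tangent[of 1 0] tangent[of 0 1] by auto
  then have "c1 - v $ 1 = 0 \<and> c2 - v $ 2 = 0"
    by (intro tangent_eq_0[OF B nondeg d]) (auto simp: n diff_left)
  then show "m = n" using d by simp
qed

text \<open>The pair \<open>a i\<close>, \<open>b i\<close> is the \<open>i\<close>-th column of the
  matrix of the shape operator; injectivity of the differential makes that operator unique.\<close>

lemma mean_curvature_eq:
  fixes X N :: "real^2 \<Rightarrow> real^3"
  assumes diff: "X differentiable (at p)" "N differentiable (at p)"
    and inj: "inj (frechet_derivative X (at p))"
    and A: "\<And>i. a i *\<^sub>R pd 1 X p + b i *\<^sub>R pd 2 X p = - pd i N p"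
  shows "mean_curvature X N p = a 1 + b 2"
proof -
  define S :: "real^2 \<Rightarrow> real^2" where
    "S v = vector [v $ 1 * a 1 + v $ 2 * a 2, v $ 1 * b 1 + v $ 2 * b 2]" for v
  have "linear S" unfolding S_def by (rule linearI) (simp_all add: vec_eq_2 algebra_simps)
  moreover have S: "frechet_derivative X (at p) (S v) = - frechet_derivative N (at p) v" for v
  proof -
    have "frechet_derivative X (at p) (S v) = v $ 1 *\<^sub>R (a 1 *\<^sub>R pd 1 X p + b 1 *\<^sub>R pd 2 X p)
        + v $ 2 *\<^sub>R (a 2 *\<^sub>R pd 1 X p + b 2 *\<^sub>R pd 2 X p)"
      unfolding frechet_derivative_pd[OF diff(1)] S_def by (simp add: algebra_simps)
    also have "\<dots> = - frechet_derivative N (at p) v"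
      unfolding A frechet_derivative_pd[OF diff(2)] by simp
    finally show ?thesis .
  qed
  ultimately have "shape_operator X N p = S"
    unfolding shape_operator_def by (intro the_equality ext) (auto intro: injD[OF inj])
  then show ?thesis
    by (simp add: mean_curvature_def trace_def sum_2 matrix_def S_def axis_def)
qed

lemma frechet_derivative_of_height:
  fixes q :: "real^3"
  assumes "(f has_real_derivative d) (at (q $ 3))"
  shows "frechet_derivative (\<lambda>q. f (q $ 3)) (at q) = (\<lambda>w. d * w $ 3)"
proof -
  have "((\<lambda>q. f (q $ 3)) has_derivative (\<lambda>w. d * w $ 3)) (at q)"
    using has_derivative_compose[OF bounded_linear_imp_has_derivative[OF bounded_linear_vec_nth[of 3]]]
      assms by (simp add: has_field_derivative_def)
  then show ?thesis using frechet_derivative_at by metis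
qed

lemma ambient_gradient_of_height:
  fixes q :: "real^3"
  assumes "(f has_real_derivative d) (at (q $ 3))"
  shows "ambient_gradient inner (\<lambda>q. f (q $ 3)) q = vector [0, 0, d]"
    and "ambient_gradient lorentz (\<lambda>q. f (q $ 3)) q = vector [0, 0, - d]"
  unfolding ambient_gradient_def frechet_derivative_of_height[OF assms]
proof -
  show "(THE G::real^3. \<forall>w. G \<bullet> w = d * w $ 3) = vector [0, 0, d]"
  proof (rule the_equality)
    fix G :: "real^3" assume G: "\<forall>w. G \<bullet> w = d * w $ 3"
    show "G = vector [0, 0, d]"
      using G[rule_format, of "axis 1 1"] G[rule_format, of "axis 2 1"] G[rule_format, of "axis 3 1"]
      by (simp add: vec_eq_3 inner_3 axis_def)
  qed (simp add: inner_3)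
  show "(THE G::real^3. \<forall>w. lorentz G w = d * w $ 3) = vector [0, 0, - d]"
  proof (rule the_equality)
    fix G :: "real^3" assume G: "\<forall>w. lorentz G w = d * w $ 3"
    show "G = vector [0, 0, - d]"
      using G[rule_format, of "axis 1 1"] G[rule_format, of "axis 2 1"] G[rule_format, of "axis 3 1"]
      by (simp add: vec_eq_3 lorentz_def axis_def)
  qed (simp add: lorentz_def)
qed

text \<open>\<open>frame1\<close>, \<open>frame2\<close> and \<open>(-a, -b, w)\<close> are the coordinate fields and the unit normal of the dual
  surface, up to a conformal factor, written in terms of the gradient \<open>(a, b)\<close> of \<open>u\<close> and
  \<open>w = sqrt (1 - a\<^sup>2 - b\<^sup>2)\<close>.\<close>

definition frame1 :: "real \<Rightarrow> real \<Rightarrow> real \<Rightarrow> real^3" where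
  "frame1 a b w = vector [1 - a * a, - (a * b), w * a]"

definition frame2 :: "real \<Rightarrow> real \<Rightarrow> real \<Rightarrow> real^3" where
  "frame2 a b w = vector [- (a * b), 1 - b * b, w * b]"

lemmas frame_defs = frame1_def frame2_def

text \<open>This is the source of the conformality: the Euclidean Gram matrix of the frame is the
  Lorentz metric of the graph.\<close>

lemma inner_frame:
  assumes "w * w = 1 - a * a - b * b"
  shows "frame1 a b w \<bullet> frame1 a b w = 1 - a * a" "frame1 a b w \<bullet> frame2 a b w = - (a * b)"
    "frame2 a b w \<bullet> frame1 a b w = - (a * b)" "frame2 a b w \<bullet> frame2 a b w = 1 - b * b"
proof -
  have "(1 - a * a) * (1 - a * a) + - (a * b) * - (a * b) + w * a * (w * a) = 1 - a * a"
    "(1 - a * a) * - (a * b) + - (a * b) * (1 - b * b) + w * a * (w * b) = - (a * b)"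
    "- (a * b) * (1 - a * a) + (1 - b * b) * - (a * b) + w * b * (w * a) = - (a * b)"
    "- (a * b) * - (a * b) + (1 - b * b) * (1 - b * b) + w * b * (w * b) = 1 - b * b"
    using assms by algebra+
  then show "frame1 a b w \<bullet> frame1 a b w = 1 - a * a" "frame1 a b w \<bullet> frame2 a b w = - (a * b)"
    "frame2 a b w \<bullet> frame1 a b w = - (a * b)" "frame2 a b w \<bullet> frame2 a b w = 1 - b * b"
    unfolding inner_3 frame_defs vector_3 .
qed

lemma inner_frame_normal:
  assumes "w * w = 1 - a * a - b * b"
  shows "frame1 a b w \<bullet> vector [- a, - b, w] = 0" "frame2 a b w \<bullet> vector [- a, - b, w] = 0"
proof -
  have "(1 - a * a) * - a + - (a * b) * - b + w * a * w = 0"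
    "- (a * b) * - a + (1 - b * b) * - b + w * b * w = 0"
    using assms by algebra+
  then show "frame1 a b w \<bullet> vector [- a, - b, w] = 0" "frame2 a b w \<bullet> vector [- a, - b, w] = 0"
    unfolding inner_3 frame_defs vector_3 .
qed

text \<open>Here \<open>x\<close>, \<open>y\<close>, \<open>z\<close> stand for derivatives of
  \<open>a\<close>, \<open>b\<close>, \<open>w\<close>, and the hypothesis is the derivative of w^2
  = 1 - a^2 - b^2.\<close>

lemma inner_frame_normal_derivative:
  assumes "w * z = - (a * x + b * y)"
  shows "frame1 a b w \<bullet> vector [- x, - y, z] = - x" "frame2 a b w \<bullet> vector [- x, - y, z] = - y"
proof -
  have "(1 - a * a) * - x + - (a * b) * - y + w * a * z = - x"
    "- (a * b) * - x + (1 - b * b) * - y + w * b * z = - y"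
    using assms by algebra+
  then show "frame1 a b w \<bullet> vector [- x, - y, z] = - x" "frame2 a b w \<bullet> vector [- x, - y, z] = - y"
    unfolding inner_3 frame_defs vector_3 .
qed

text \<open>The tangential coefficients are inner products with (1, 0, a/w) and (0, 1, b/w), the
  basis of the plane orthogonal to the normal that is dual to the frame.\<close>

lemma frame_expansion:
  fixes v :: "real^3"
  assumes "w * w = 1 - a * a - b * b" "w \<noteq> 0"
  shows "v = (v \<bullet> vector [- a, - b, w]) *\<^sub>R vector [- a, - b, w]
    + (v $ 1 + a * v $ 3 / w) *\<^sub>R frame1 a b w + (v $ 2 + b * v $ 3 / w) *\<^sub>R frame2 a b w"
proof -
  obtain x y z where v: "v $ 1 = x" "v $ 2 = y" "v $ 3 = z" by blast
  \<comment> \<open>Writing the third component as a multiple of \<open>w\<close> removes the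
    division, so that the three component identities become polynomial.\<close>
  define t where "t = z / w"
  have z: "z = t * w" using assms(2) by (simp add: t_def)
  have "x = (x * - a + y * - b + t * w * w) * - a + (x + a * t) * (1 - a * a) + (y + b * t) * - (a * b)"
    "y = (x * - a + y * - b + t * w * w) * - b + (x + a * t) * - (a * b) + (y + b * t) * (1 - b * b)"
    "t * w = (x * - a + y * - b + t * w * w) * w + (x + a * t) * (w * a) + (y + b * t) * (w * b)"
    using assms(1) by algebra+
  then show ?thesis
    using assms(2)
    by (simp add: vec_eq_3 inner_3 frame_defs v z)
qed

text \<open>The Weingarten equation: the coefficients are the cofactor matrix of the Gram matrix,
  whose determinant is w^2, applied to (x, y).\<close>

lemma frame_combination:
  assumes "w * w = 1 - a * a - b * b" "w * z = - (a * x + b * y)"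
  shows "((1 - b * b) * x + a * b * y) *\<^sub>R frame1 a b w + (a * b * x + (1 - a * a) * y) *\<^sub>R frame2 a b w
    = - (w * w) *\<^sub>R vector [- x, - y, z]"
proof -
  have "((1 - b * b) * x + a * b * y) * (1 - a * a) + (a * b * x + (1 - a * a) * y) * - (a * b) = - (w * w) * - x"
    "((1 - b * b) * x + a * b * y) * - (a * b) + (a * b * x + (1 - a * a) * y) * (1 - b * b) = - (w * w) * - y"
    "((1 - b * b) * x + a * b * y) * (w * a) + (a * b * x + (1 - a * a) * y) * (w * b) = - (w * w) * z"
    using assms by algebra+
  then show ?thesis
    unfolding vec_eq_3 frame_defs vector_3 vector_add_component vector_scaleR_component by auto
qed

section \<open>The dual surface\<close>

locale dual_graph =
  fixes \<Omega> :: "(real^2) set" and I :: "real set"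
    and \<phi> \<theta> :: "real \<Rightarrow> real" and u \<phi>b :: "real^2 \<Rightarrow> real"
  assumes open_\<Omega>: "open \<Omega>"
    and interval: "open I" "is_interval I"
    and maximal: "maximal_on I \<phi> (graph_param u) \<Omega>"
    and \<phi>b_C2: "Ck_on 2 \<phi>b \<Omega>"
    and \<phi>b_xx: "\<And>p. p \<in> \<Omega> \<Longrightarrow> pd 1 (pd 1 \<phi>b) p = (1 - (pd 1 u p)\<^sup>2) / W_bar u p * exp (\<phi> (u p))"
    and \<phi>b_xy: "\<And>p. p \<in> \<Omega> \<Longrightarrow>
      pd 2 (pd 1 \<phi>b) p = - (pd 1 u p * pd 2 u p / W_bar u p) * exp (\<phi> (u p))"
    and \<phi>b_yy: "\<And>p. p \<in> \<Omega> \<Longrightarrow> pd 2 (pd 2 \<phi>b) p = (1 - (pd 2 u p)\<^sup>2) / W_bar u p * exp (\<phi> (u p))"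
    and primitive: "\<And>t. t \<in> I \<Longrightarrow> (\<theta> has_real_derivative exp (\<phi> t)) (at t)"
begin

abbreviation "X \<equiv> graph_param u"
abbreviation "Y \<equiv> dual_surface \<phi>b \<theta> u"
abbreviation "N \<equiv> dual_gauss_map u"
abbreviation "Nb \<equiv> lorentz_gauss_map u"
abbreviation "W \<equiv> W_bar u"
abbreviation "a \<equiv> pd 1 u"
abbreviation "b \<equiv> pd 2 u"
abbreviation "E p \<equiv> exp (\<phi> (u p))"

section \<open>The spacelike graph and its gradient bound\<close>

lemma smooth_X: "smooth_on X \<Omega>" and smooth_\<phi>: "smooth_on \<phi> I"
  and spacelike: "spacelike_on X \<Omega>"
  using maximal by (auto simp: maximal_on_def weighted_stationary_on_def immersion_on_def)

lemma u_in_I: "p \<in> \<Omega> \<Longrightarrow> u p \<in> I"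
  using maximal by (auto simp: maximal_on_def weighted_stationary_on_def graph_param_def)

lemma smooth_u: "smooth_on u \<Omega>"
  using smooth_on_bounded_linear[OF open_\<Omega> bounded_linear_vec_nth[of 3] smooth_X]
  by (simp add: graph_param_def)

lemmas smooth_ab = smooth_on_pd[OF smooth_u]

lemma differentiable_ab: "p \<in> \<Omega> \<Longrightarrow> pd i u differentiable (at p)"
  by (rule smooth_on_differentiable[OF smooth_ab])

lemma u_xy: "p \<in> \<Omega> \<Longrightarrow> pd 1 b p = pd 2 a p"
  using pd_commute[OF open_\<Omega>, of u p 1 2] smooth_u by (simp add: smooth_on_def)

lemma pd_nth_on: "smooth_on F \<Omega> \<Longrightarrow> p \<in> \<Omega> \<Longrightarrow> pd i F p $ k = pd i (\<lambda>q. F q $ k) p"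
  by (rule pd_nth[symmetric]) (rule smooth_on_differentiable)

lemma pd_X:
  assumes "p \<in> \<Omega>"
  shows "pd 1 X p = vector [1, 0, a p]" "pd 2 X p = vector [0, 1, b p]"
proof -
  have c: "pd i (\<lambda>q. q $ k) p = axis i (1::real) $ k" for i k :: 2
    by (rule pd_eq[OF bounded_linear_imp_has_derivative[OF bounded_linear_vec_nth]])
  show "pd 1 X p = vector [1, 0, a p]" "pd 2 X p = vector [0, 1, b p]"
    unfolding vec_eq_3 pd_nth_on[OF smooth_X assms] by (auto simp: graph_param_def c axis_def)
qed

lemma pd_pd_X:
  assumes "p \<in> \<Omega>"
  shows "pd i (pd j X) p = vector [0, 0, pd i (pd j u) p]"
proof -
  have "pd i (\<lambda>q. pd j X q $ k) p = pd i (\<lambda>q. (vector [if j = 1 then 1 else 0, if j = 2 then 1 else 0, pd j u q] :: real^3) $ k) p" for k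
    using exhaust_2[of j] by (intro pd_cong[OF open_\<Omega> assms]) (auto simp: pd_X)
  moreover have "pd i (\<lambda>q. c) p = 0" for c :: real
    by (simp add: pd_def)
  moreover have "(\<lambda>q. pd j u q) = pd j u" by simp
  ultimately show ?thesis
    unfolding vec_eq_3 pd_nth_on[OF smooth_on_pd[OF smooth_X] assms] by simp
qed

lemma metric_X:
  assumes "p \<in> \<Omega>"
  shows "induced_metric lorentz X p $ 1 $ 1 = 1 - (a p)\<^sup>2"
    "induced_metric lorentz X p $ 1 $ 2 = - (a p * b p)"
    "induced_metric lorentz X p $ 2 $ 1 = - (a p * b p)"
    "induced_metric lorentz X p $ 2 $ 2 = 1 - (b p)\<^sup>2"
  using assms by (simp_all add: induced_metric_nth pd_X lorentz_def power2_eq_square)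

lemma metric_pos:
  fixes v :: "real^2"
  assumes "p \<in> \<Omega>" "v \<noteq> 0"
  shows "(v $ 1)\<^sup>2 * (1 - (a p)\<^sup>2) - 2 * (v $ 1 * v $ 2 * a p * b p) + (v $ 2)\<^sup>2 * (1 - (b p)\<^sup>2) > 0"
proof -
  have "v \<bullet> (induced_metric lorentz X p *v v) > 0"
    using spacelike assms by (simp add: spacelike_on_def)
  then show ?thesis
    by (simp add: inner_vec_def matrix_vector_mult_def sum_2 metric_X[OF assms(1)]
        power2_eq_square algebra_simps)
qed

text \<open>The test vector for positive definiteness is the gradient of \<open>u\<close> itself,
  along which the metric shrinks most.\<close>

lemma gradient_lt_1:
  assumes "p \<in> \<Omega>"
  shows "1 - (a p)\<^sup>2 - (b p)\<^sup>2 > 0"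
proof (rule ccontr)
  assume *: "\<not> 1 - (a p)\<^sup>2 - (b p)\<^sup>2 > 0"
  then have "(vector [a p, b p] :: real^2) \<noteq> 0" by (auto simp: vec_eq_2)
  from metric_pos[OF assms this]
  have "((a p)\<^sup>2 + (b p)\<^sup>2) * (1 - (a p)\<^sup>2 - (b p)\<^sup>2) > 0"
    by (simp add: power2_eq_square algebra_simps)
  then show False using * by (simp add: zero_less_mult_iff)
qed

lemma W_pos: "p \<in> \<Omega> \<Longrightarrow> W p > 0"
  and W_square: "p \<in> \<Omega> \<Longrightarrow> W p * W p = 1 - a p * a p - b p * b p"
  using gradient_lt_1[of p] by (simp_all add: W_bar_def power2_eq_square)

lemma smooth_W: "smooth_on W \<Omega>"
  unfolding W_bar_def[abs_def] power2_eq_square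
  using gradient_lt_1
  by (intro smooth_on_compose_real[OF open_\<Omega> smooth_on_sqrt] smooth_on_diff smooth_on_mult
      smooth_on_const smooth_ab open_\<Omega>) (auto simp: power2_eq_square)

lemma pd_W:
  assumes "p \<in> \<Omega>"
  shows "W p * pd i W p = - (a p * pd i a p + b p * pd i b p)"
proof -
  note d = differentiable_ab[OF assms] smooth_on_differentiable[OF smooth_W assms]
  have "pd i (\<lambda>q. W q * W q + (a q * a q + b q * b q)) p = pd i (\<lambda>q. 1) p"
    by (rule pd_cong[OF open_\<Omega> assms]) (simp add: W_square)
  then have "pd i W p * W p + W p * pd i W p + (pd i a p * a p + a p * pd i a p + (pd i b p * b p + b p * pd i b p)) = 0"
    by (simp add: pd_add pd_mult d) (simp add: pd_def algebra_simps)
  then show ?thesis by (simp add: algebra_simps)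
qed

section \<open>Smoothness and first derivatives of the dual surface and the Gauss maps\<close>

lemma smooth_E: "smooth_on E \<Omega>"
  using u_in_I
  by (intro smooth_on_compose_real[OF open_\<Omega> smooth_on_exp] smooth_on_compose_real[OF open_\<Omega> smooth_\<phi>] smooth_u) auto

lemma smooth_\<theta>: "smooth_on \<theta> I"
  by (rule smooth_on_real_derivI[OF interval(1) primitive])
    (auto intro: smooth_on_compose_real[OF interval(1) smooth_on_exp smooth_\<phi>])

lemma smooth_\<theta>u: "smooth_on (\<lambda>p. \<theta> (u p)) \<Omega>"
  using u_in_I by (intro smooth_on_compose_real[OF open_\<Omega> smooth_\<theta> smooth_u]) auto

lemma differentiable_\<phi>b: "p \<in> \<Omega> \<Longrightarrow> \<phi>b differentiable (at p)"
  and differentiable_pd_\<phi>b: "p \<in> \<Omega> \<Longrightarrow> pd i \<phi>b differentiable (at p)"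
  using \<phi>b_C2 by (simp_all add: numeral_2_eq_2 pd_def[abs_def])

lemma \<phi>b_yx: "p \<in> \<Omega> \<Longrightarrow> pd 1 (pd 2 \<phi>b) p = - (a p * b p / W p) * E p"
  using pd_commute[OF open_\<Omega> \<phi>b_C2, of p 1 2] \<phi>b_xy by simp

text \<open>Although \<open>\<phi>b\<close> is assumed to be C^2 only, the system expresses its
  second derivatives by smooth functions of \<open>u\<close> and its gradient, so its first
  derivatives are smooth.\<close>

lemma smooth_pd_\<phi>b: "smooth_on (pd i \<phi>b) \<Omega>"
proof (rule smooth_on_SucI[OF open_\<Omega> has_derivative_pd[OF differentiable_pd_\<phi>b]])
  fix v :: "real^2"
  have s: "smooth_on (\<lambda>p. (1 - (pd k u p)\<^sup>2) / W p * E p) \<Omega>"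
    "smooth_on (\<lambda>p. - (a p * b p / W p) * E p) \<Omega>" for k
    unfolding power2_eq_square
    by (intro smooth_on_mult smooth_on_divide smooth_on_minus smooth_on_diff smooth_on_const smooth_ab
        smooth_W smooth_E open_\<Omega> W_pos; assumption)+
  have "smooth_on (pd k (pd i \<phi>b)) \<Omega>" for k
    using exhaust_2[of i] exhaust_2[of k]
    by (auto intro: smooth_on_cong[OF open_\<Omega> s(1)[of 1]] smooth_on_cong[OF open_\<Omega> s(1)[of 2]]
        smooth_on_cong[OF open_\<Omega> s(2)] simp: \<phi>b_xx \<phi>b_xy \<phi>b_yx \<phi>b_yy)
  then show "smooth_on (\<lambda>x. v $ 1 *\<^sub>R pd 1 (pd i \<phi>b) x + v $ 2 *\<^sub>R pd 2 (pd i \<phi>b) x) \<Omega>"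
    by (intro smooth_on_add[OF open_\<Omega>] smooth_on_bounded_linear[OF open_\<Omega> bounded_linear_scaleR_right])
qed

lemma smooth_Y: "smooth_on Y \<Omega>"
  unfolding dual_surface_def[abs_def]
  by (intro smooth_on_vector_3 smooth_pd_\<phi>b smooth_\<theta>u open_\<Omega>)

lemma pd_Y:
  assumes "p \<in> \<Omega>"
  shows "pd 1 Y p = (E p / W p) *\<^sub>R vector [1 - a p * a p, - (a p * b p), W p * a p]"
    "pd 2 Y p = (E p / W p) *\<^sub>R vector [- (a p * b p), 1 - b p * b p, W p * b p]"
proof -
  have "pd i (\<lambda>q. \<theta> (u q)) p = E p * pd i u p" for i
    by (rule pd_compose_real[OF primitive[OF u_in_I[OF assms]] smooth_on_differentiable[OF smooth_u assms]])
  moreover have "(\<lambda>q. pd i \<phi>b q) = pd i \<phi>b" for i by simp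
  ultimately show "pd 1 Y p = (E p / W p) *\<^sub>R vector [1 - a p * a p, - (a p * b p), W p * a p]"
    "pd 2 Y p = (E p / W p) *\<^sub>R vector [- (a p * b p), 1 - b p * b p, W p * b p]"
    using W_pos[OF assms]
    unfolding vec_eq_3 pd_nth_on[OF smooth_Y assms]
    by (simp_all add: dual_surface_def \<phi>b_xx \<phi>b_xy \<phi>b_yx \<phi>b_yy assms power2_eq_square)
qed

lemma smooth_N: "smooth_on N \<Omega>"
  unfolding dual_gauss_map_def[abs_def]
  by (intro smooth_on_vector_3 smooth_on_minus smooth_ab smooth_W open_\<Omega>)

lemma pd_N:
  assumes "p \<in> \<Omega>"
  shows "pd i N p = vector [- pd i a p, - pd i b p, pd i W p]"
proof -
  have "(\<lambda>q. W q) = W" by simp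
  then show ?thesis
    unfolding vec_eq_3 pd_nth_on[OF smooth_N assms]
    by (simp add: dual_gauss_map_def pd_minus differentiable_ab assms)
qed

lemma smooth_Nb: "smooth_on Nb \<Omega>"
  unfolding lorentz_gauss_map_def[abs_def]
  by (intro smooth_on_bounded_bilinear[OF open_\<Omega> bounded_bilinear_scaleR] smooth_on_divide
      smooth_on_vector_3 smooth_on_const smooth_ab smooth_W open_\<Omega> W_pos)

text \<open>Multiplying by \<open>W\<close> turns the Gauss map into (a, b, 1), so the product rule
  replaces the differentiation of a quotient.\<close>

lemma pd_Nb:
  assumes "p \<in> \<Omega>"
  shows "W p *\<^sub>R pd i Nb p = vector [pd i a p, pd i b p, 0] - pd i W p *\<^sub>R Nb p"
proof -
  let ?F = "\<lambda>q. vector [a q, b q, 1] :: real^3"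
  have F: "smooth_on ?F \<Omega>" by (intro smooth_on_vector_3 smooth_on_const smooth_ab open_\<Omega>)
  have "pd i (\<lambda>q. W q *\<^sub>R Nb q) p = pd i ?F p"
  proof (rule pd_cong[OF open_\<Omega> assms])
    show "W q *\<^sub>R Nb q = ?F q" if "q \<in> \<Omega>" for q
      using W_pos[OF that] by (simp add: lorentz_gauss_map_def)
  qed
  moreover have "pd i ?F p = vector [pd i a p, pd i b p, 0]"
    unfolding vec_eq_3 pd_nth_on[OF F assms] by (simp add: pd_def[of i "\<lambda>q. 1"])
  moreover have "pd i (\<lambda>q. W q *\<^sub>R Nb q) p = W p *\<^sub>R pd i Nb p + pd i W p *\<^sub>R Nb p"
    by (rule pd_bounded_bilinear[OF bounded_bilinear_scaleR])
      (auto intro: smooth_on_differentiable[OF _ assms] smooth_W smooth_Nb)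
  ultimately show ?thesis by (simp add: algebra_simps)
qed

section \<open>Metrics and normal projections\<close>

lemma pd_Y_frame:
  assumes "p \<in> \<Omega>"
  shows "pd 1 Y p = (E p / W p) *\<^sub>R frame1 (a p) (b p) (W p)"
    "pd 2 Y p = (E p / W p) *\<^sub>R frame2 (a p) (b p) (W p)"
  using pd_Y[OF assms] by (simp_all add: frame_defs)

lemma metric_Y:
  assumes "p \<in> \<Omega>"
  shows "induced_metric inner Y p = (exp (2 * \<phi> (u p)) / (W p)\<^sup>2) *\<^sub>R induced_metric lorentz X p"
proof -
  define k where "k = E p / W p"
  have k: "exp (2 * \<phi> (u p)) / (W p)\<^sup>2 = k * k"
    by (simp add: k_def exp_double power2_eq_square)
  show ?thesis
    unfolding k
    by (simp add: vec_eq_2 metric_X[OF assms] power2_eq_square)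
      (simp add: induced_metric_nth pd_Y_frame[OF assms] inner_frame[OF W_square[OF assms]] flip: k_def)
qed

lemma det_metric_X:
  assumes "p \<in> \<Omega>"
  shows "det (induced_metric lorentz X p) = W p * W p"
  unfolding det_2 using metric_X[OF assms] W_square[OF assms] by algebra

lemma det_metric_Y:
  assumes "p \<in> \<Omega>"
  shows "det (induced_metric inner Y p) = E p ^ 4 / (W p * W p)"
proof -
  define k where "k = E p / W p"
  have k: "exp (2 * \<phi> (u p)) / (W p)\<^sup>2 = k * k"
    by (simp add: k_def exp_double power2_eq_square)
  have "det (induced_metric inner Y p) = (k * k) * (k * k) * det (induced_metric lorentz X p)"
    unfolding metric_Y[OF assms] k det_2 by (simp add: algebra_simps)
  then show ?thesis
    using W_pos[OF assms] by (simp add: det_metric_X[OF assms] k_def power4_eq_xxxx)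
qed

lemma nondegenerate:
  assumes "p \<in> \<Omega>"
  shows "det (induced_metric lorentz X p) \<noteq> 0" "det (induced_metric inner Y p) \<noteq> 0"
  using W_pos[OF assms] by (simp_all add: det_metric_X det_metric_Y assms)

lemma inv_metric_X:
  assumes "p \<in> \<Omega>"
  shows "matrix_inv (induced_metric lorentz X p) $ 1 $ 1 = (1 - b p * b p) / (W p * W p)"
    "matrix_inv (induced_metric lorentz X p) $ 1 $ 2 = a p * b p / (W p * W p)"
    "matrix_inv (induced_metric lorentz X p) $ 2 $ 1 = a p * b p / (W p * W p)"
    "matrix_inv (induced_metric lorentz X p) $ 2 $ 2 = (1 - a p * a p) / (W p * W p)"
  by (simp_all add: matrix_inv_2[OF nondegenerate(1)[OF assms]] det_metric_X[OF assms]
      metric_X[OF assms] power2_eq_square)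

lemma inv_metric_Y:
  assumes "p \<in> \<Omega>"
  shows "matrix_inv (induced_metric inner Y p) $ 1 $ 1 = (1 - b p * b p) / (E p * E p)"
    "matrix_inv (induced_metric inner Y p) $ 1 $ 2 = a p * b p / (E p * E p)"
    "matrix_inv (induced_metric inner Y p) $ 2 $ 1 = a p * b p / (E p * E p)"
    "matrix_inv (induced_metric inner Y p) $ 2 $ 2 = (1 - a p * a p) / (E p * E p)"
  unfolding matrix_inv_2[OF nondegenerate(2)[OF assms]] det_metric_Y[OF assms]
  unfolding metric_Y[OF assms]
  using W_pos[OF assms]
  by (simp_all add: metric_X[OF assms] power2_eq_square power4_eq_xxxx exp_double)

lemma differentiable_XY:
  assumes "p \<in> \<Omega>"
  shows "X differentiable (at p)" "Y differentiable (at p)" "N differentiable (at p)"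
    "Nb differentiable (at p)"
  by (auto intro: smooth_on_differentiable[OF _ assms] smooth_X smooth_Y smooth_N smooth_Nb)

lemma orthogonal_N:
  assumes "p \<in> \<Omega>"
  shows "pd i Y p \<bullet> N p = 0"
  using exhaust_2[of i]
  by (auto simp: pd_Y_frame[OF assms] dual_gauss_map_def inner_frame_normal[OF W_square[OF assms]])

lemma inner_pd_pd_Y_N:
  assumes "p \<in> \<Omega>"
  shows "pd i (pd j Y) p \<bullet> N p = E p / W p * pd i (pd j u) p"
proof -
  have d: "pd j Y differentiable (at p)"
    by (intro smooth_on_differentiable[OF _ assms] smooth_on_pd smooth_Y)
  have "pd i (\<lambda>q. pd j Y q \<bullet> N q) p = pd i (\<lambda>q. 0) p"
    by (rule pd_cong[OF open_\<Omega> assms orthogonal_N])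
  then have "pd j Y p \<bullet> pd i N p + pd i (pd j Y) p \<bullet> N p = 0"
    using pd_bounded_bilinear[OF bounded_bilinear_inner d differentiable_XY(3)[OF assms]]
    by (simp add: pd_def[of _ "\<lambda>q. 0"])
  moreover have "pd j Y p \<bullet> pd i N p = - (E p / W p * pd i (pd j u) p)"
    using exhaust_2[of j]
    by (auto simp: pd_Y_frame[OF assms] pd_N[OF assms]
        inner_frame_normal_derivative[OF pd_W[OF assms]])
  ultimately show ?thesis by simp
qed

lemma normal_part_Y:
  assumes "p \<in> \<Omega>"
  shows "normal_part inner Y p w = (w \<bullet> N p) *\<^sub>R N p"
proof (rule normal_part_eq[OF bounded_bilinear_inner differentiable_XY(2)[OF assms] nondegenerate(2)[OF assms]])
  \<comment> \<open>The coefficients are those of \<open>frame_expansion\<close> times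
    \<open>W p / E p\<close>, which undoes the conformal factor between the frame and the coordinate
    fields of \<open>Y\<close>.\<close>
  have c: "(W p * x + c * y) / E p * (E p / W p) = x + c * y / W p" for x y c
    using W_pos[OF assms] by (simp add: field_simps)
  show "w = (w \<bullet> N p) *\<^sub>R N p + ((W p * w $ 1 + a p * w $ 3) / E p) *\<^sub>R pd 1 Y p
      + ((W p * w $ 2 + b p * w $ 3) / E p) *\<^sub>R pd 2 Y p"
    unfolding pd_Y_frame[OF assms] scaleR_scaleR c dual_gauss_map_def
    using W_pos[OF assms] by (intro frame_expansion[OF W_square[OF assms]]) simp
qed (use orthogonal_N[OF assms] in \<open>simp_all add: inner_commute\<close>)

text \<open>Vertical vectors suffice: the second derivatives of a graph and the gradient of a
  function of the height are both vertical.\<close>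

lemma normal_part_X:
  assumes "p \<in> \<Omega>"
  shows "normal_part lorentz X p (vector [0, 0, t]) = (t / W p) *\<^sub>R Nb p"
proof (rule normal_part_eq[OF bounded_bilinear_lorentz differentiable_XY(1)[OF assms] nondegenerate(1)[OF assms]])
  show "vector [0, 0, t] = (t / W p) *\<^sub>R Nb p + (- (t * a p / (W p * W p))) *\<^sub>R pd 1 X p
      + (- (t * b p / (W p * W p))) *\<^sub>R pd 2 X p"
  proof -
    have "t = t * (1 - a p * a p - b p * b p) / (W p * W p)"
      unfolding W_square[OF assms, symmetric] using W_pos[OF assms] by simp
    then have "t = t / (W p * W p) - t * a p / (W p * W p) * a p - t * b p / (W p * W p) * b p"
      by (simp add: diff_divide_distrib right_diff_distrib)
    then show ?thesis by (simp add: vec_eq_3 pd_X[OF assms] lorentz_gauss_map_def)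
  qed
qed (simp_all add: pd_X[OF assms] lorentz_def lorentz_gauss_map_def)

section \<open>The weight of the dual surface\<close>

definition "dual_weight s = - \<phi> (inv_into I \<theta> s)"

lemma inj_on_\<theta>: "inj_on \<theta> I"
proof (rule inj_onI, rule ccontr)
  fix s t assume st: "s \<in> I" "t \<in> I" "\<theta> s = \<theta> t" "s \<noteq> t"
  have less: "\<theta> s < \<theta> t" if "s \<in> I" "t \<in> I" "s < t" for s t
  proof (rule DERIV_pos_imp_increasing[OF that(3)])
    fix x assume "s \<le> x" "x \<le> t"
    then have "x \<in> I" using interval(2) that unfolding is_interval_1 by blast
    then show "\<exists>y. DERIV \<theta> x :> y \<and> y > 0" using primitive by (intro exI[of _ "exp (\<phi> x)"]) auto
  qed
  show False using less[of s t] less[of t s] st by linarith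
qed

lemma open_\<theta>_image: "open (\<theta> ` I)" and smooth_dual_weight: "smooth_on dual_weight (\<theta> ` I)"
proof -
  \<comment> \<open>The one-dimensional instance: the derivative of \<theta> is multiplication by
    \<open>exp (\<phi> t)\<close>, and its inverse is multiplication by
    \<open>exp (- \<phi> t)\<close>.\<close>
  note * = smooth_on_compose_inv_into[OF interval(1) inj_on_\<theta>,
      where L' = "\<lambda>t. (*) (exp (\<phi> t))" and M = "\<lambda>t. (*) (exp (- \<phi> t))", OF _ _ _ _ smooth_\<phi>]
  have "smooth_on (\<lambda>x. frechet_derivative g (at x) (exp (- \<phi> x) * v)) I"
    if g: "smooth_on g I" for g :: "real \<Rightarrow> real" and v
  proof (rule smooth_on_cong[OF interval(1)])
    show "smooth_on (\<lambda>x. exp (- \<phi> x) * frechet_derivative g (at x) v) I"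
      by (intro smooth_on_mult smooth_on_compose_real[OF interval(1) smooth_on_exp]
          smooth_on_minus smooth_\<phi> smooth_on_frechet_derivative g interval) auto
    show "exp (- \<phi> x) * frechet_derivative g (at x) v = frechet_derivative g (at x) (exp (- \<phi> x) * v)"
      if "x \<in> I" for x
      using linear_cmul[OF linear_frechet_derivative[OF smooth_on_differentiable[OF g that]],
          of "exp (- \<phi> x)" v] by simp
  qed
  note * = *[OF primitive[unfolded has_field_derivative_def] bounded_linear_mult_right _ this]
  have "open (\<theta> ` I) \<and> smooth_on (\<lambda>s. \<phi> (inv_into I \<theta> s)) (\<theta> ` I)"
    by (rule conjI; rule *) (auto simp: fun_eq_iff exp_minus)
  then show "open (\<theta> ` I)" "smooth_on dual_weight (\<theta> ` I)"
    unfolding dual_weight_def[abs_def] using smooth_on_minus by auto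
qed

text \<open>Smoothness gives some derivative; the chain rule for the composite with \<theta>, which
  is the negative of \<phi> on \<open>I\<close>, determines its value.\<close>

lemma dual_weight_has_derivative:
  assumes "t \<in> I" "(\<phi> has_real_derivative d) (at t)"
  shows "(dual_weight has_real_derivative - d / exp (\<phi> t)) (at (\<theta> t))"
proof -
  have "dual_weight differentiable (at (\<theta> t))"
    using smooth_on_differentiable[OF smooth_dual_weight] assms(1) by blast
  then obtain D where D: "(dual_weight has_real_derivative D) (at (\<theta> t))"
    using real_differentiableE by blast
  have "((\<lambda>s. dual_weight (\<theta> s)) has_real_derivative D * exp (\<phi> t)) (at t)"
    by (rule DERIV_chain2[OF D primitive[OF assms(1)]])
  moreover have "((\<lambda>s. dual_weight (\<theta> s)) has_real_derivative - d) (at t)"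
    by (rule has_field_derivative_transform_within_open[OF DERIV_minus[OF assms(2)] interval(1) assms(1)])
      (simp add: dual_weight_def inj_on_\<theta>)
  ultimately have "D * exp (\<phi> t) = - d" by (rule DERIV_unique)
  then have "D = - d / exp (\<phi> t)" by (simp add: field_simps)
  then show ?thesis using D by simp
qed


section \<open>Mean and Gauss curvatures\<close>

definition hessian_trace :: "real^2 \<Rightarrow> real" where
  "hessian_trace p = (1 - b p * b p) * pd 1 a p + 2 * (a p * b p) * pd 1 b p + (1 - a p * a p) * pd 2 b p"

text \<open>\<open>hessian_trace\<close> is W^2 times the trace of the Hessian of \<open>u\<close>
  in the metric of the graph. Both sides of the vector equation are multiples of \<open>Nb\<close>,
  whose third component 1/W is nonzero, so comparing third components gives the scalar equation. The
  sign comes from the Lorentz gradient of the height.\<close>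

lemma maximal_equation:
  assumes "p \<in> \<Omega>" "(\<phi> has_real_derivative d) (at (u p))"
  shows "hessian_trace p = - d * (W p * W p)"
proof -
  have "mean_curvature_vector lorentz X p
      = normal_part lorentz X p (ambient_gradient lorentz (\<lambda>q. \<phi> (q $ 3)) (X p))"
    using maximal assms(1) by (simp add: maximal_on_def weighted_stationary_on_def)
  moreover have "ambient_gradient lorentz (\<lambda>q. \<phi> (q $ 3)) (X p) = vector [0, 0, - d]"
    by (rule ambient_gradient_of_height) (simp add: graph_param_def assms(2))
  moreover have "mean_curvature_vector lorentz X p = (hessian_trace p / (W p * W p * W p)) *\<^sub>R Nb p"
  proof -
    \<comment> \<open>All divisions are moved into one common factor, so that \<open>algebra\<close>
      faces a polynomial identity.\<close>
    have c: "q / (W p * W p) * (x / W p) = q * x * (1 / (W p * W p * W p))" for q x by simp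
    have "hessian_trace p / (W p * W p * W p) = hessian_trace p * (1 / (W p * W p * W p))" by simp
    then have tr: "(1 - b p * b p) / (W p * W p) * (pd 1 a p / W p) + a p * b p / (W p * W p) * (pd 1 b p / W p)
        + (a p * b p / (W p * W p) * (pd 2 a p / W p) + (1 - a p * a p) / (W p * W p) * (pd 2 b p / W p))
      = hessian_trace p / (W p * W p * W p)"
      unfolding c using u_xy[OF assms(1)] hessian_trace_def[of p] by algebra
    show ?thesis
      unfolding mean_curvature_vector_def second_fundamental_form_def pd_pd_X[OF assms(1)] tr
        normal_part_X[OF assms(1)] sum_2 inv_metric_X[OF assms(1)] scaleR_scaleR scaleR_add_left[symmetric] ..
  qed
  ultimately have "(hessian_trace p / (W p * W p * W p)) *\<^sub>R Nb p = (- d / W p) *\<^sub>R Nb p"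
    by (simp add: normal_part_X[OF assms(1)])
  then have "hessian_trace p / (W p * W p * W p) * Nb p $ 3 = - d / W p * Nb p $ 3"
    by (metis vector_scaleR_component real_scaleR_def)
  then show ?thesis
    using W_pos[OF assms(1)] by (simp add: lorentz_gauss_map_def field_simps)
qed

text \<open>With T the trace and d the derivative of \<phi> at the height \<open>u p\<close>, the
  mean curvature vector is T / (E W) times \<open>N\<close> and the projected gradient is - d W / E
  times \<open>N\<close>; \<open>maximal_equation\<close> says precisely that these agree.\<close>

lemma minimal_Y: "minimal_on (\<theta> ` I) dual_weight Y \<Omega>"
  unfolding minimal_on_def weighted_stationary_on_def immersion_on_def
proof (intro conjI ballI)
  show "open (\<theta> ` I)" "smooth_on dual_weight (\<theta> ` I)" "smooth_on Y \<Omega>"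
    by (fact open_\<theta>_image smooth_dual_weight smooth_Y)+
  fix p assume p: "p \<in> \<Omega>"
  show "inj (frechet_derivative Y (at p))"
    by (rule inj_frechet_derivative_of_nondegenerate[OF bounded_bilinear_inner
          differentiable_XY(2)[OF p] nondegenerate(2)[OF p]])
  show "Y p $ 3 \<in> \<theta> ` I"
    using u_in_I[OF p] by (simp add: dual_surface_def)
  obtain d where d: "(\<phi> has_real_derivative d) (at (u p))"
    using smooth_on_differentiable[OF smooth_\<phi> u_in_I[OF p]] real_differentiableE by blast
  have "ambient_gradient inner (\<lambda>q. dual_weight (q $ 3)) (Y p) = vector [0, 0, - d / E p]"
    by (rule ambient_gradient_of_height)
      (simp add: dual_surface_def dual_weight_has_derivative[OF u_in_I[OF p] d, simplified])
  then have "normal_part inner Y p (ambient_gradient inner (\<lambda>q. dual_weight (q $ 3)) (Y p))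
      = (- d / E p * W p) *\<^sub>R N p"
    by (simp add: normal_part_Y[OF p] inner_3 dual_gauss_map_def[of u p])
  moreover have "mean_curvature_vector inner Y p = (hessian_trace p / (E p * W p)) *\<^sub>R N p"
  proof -
    have c: "q / (E p * E p) * (E p / W p * x) = q * x * (1 / (E p * W p))" for q x by simp
    have "hessian_trace p / (E p * W p) = hessian_trace p * (1 / (E p * W p))" by simp
    then have tr: "(1 - b p * b p) / (E p * E p) * (E p / W p * pd 1 a p)
        + a p * b p / (E p * E p) * (E p / W p * pd 1 b p)
        + (a p * b p / (E p * E p) * (E p / W p * pd 2 a p)
          + (1 - a p * a p) / (E p * E p) * (E p / W p * pd 2 b p))
      = hessian_trace p / (E p * W p)"
      unfolding c using u_xy[OF p] hessian_trace_def[of p] by algebra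
    show ?thesis
      unfolding mean_curvature_vector_def second_fundamental_form_def tr
        normal_part_Y[OF p] sum_2 inv_metric_Y[OF p] inner_pd_pd_Y_N[OF p]
        scaleR_scaleR scaleR_add_left[symmetric] ..
  qed
  moreover have "hessian_trace p / (E p * W p) = - d / E p * W p"
    unfolding maximal_equation[OF p d] using W_pos[OF p] by simp
  ultimately show "mean_curvature_vector inner Y p
      = normal_part inner Y p (ambient_gradient inner (\<lambda>q. dual_weight (q $ 3)) (Y p))" by simp
qed

lemma mean_curvature_Y:
  assumes "p \<in> \<Omega>"
  shows "mean_curvature Y N p = hessian_trace p / (E p * W p)"
proof -
  \<comment> \<open>\<open>frame_combination\<close> contributes 1 / W^2, and passing from the frame
    to the coordinate fields of \<open>Y\<close> contributes W / E.\<close>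
  define c where "c = 1 / (E p * W p)"
  have "mean_curvature Y N p
      = c * ((1 - b p * b p) * pd 1 a p + a p * b p * pd 1 b p)
        + c * (a p * b p * pd 2 a p + (1 - a p * a p) * pd 2 b p)"
  proof (rule mean_curvature_eq[OF differentiable_XY(2,3)[OF assms],
        where a = "\<lambda>i. c * ((1 - b p * b p) * pd i a p + a p * b p * pd i b p)"
          and b = "\<lambda>i. c * (a p * b p * pd i a p + (1 - a p * a p) * pd i b p)"])
    show "inj (frechet_derivative Y (at p))"
      by (rule inj_frechet_derivative_of_nondegenerate[OF bounded_bilinear_inner
          differentiable_XY(2)[OF assms] nondegenerate(2)[OF assms]])
    show "(c * ((1 - b p * b p) * pd i a p + a p * b p * pd i b p)) *\<^sub>R pd 1 Y p
        + (c * (a p * b p * pd i a p + (1 - a p * a p) * pd i b p)) *\<^sub>R pd 2 Y p = - pd i N p" for i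
    proof -
      have c: "c * x * (E p / W p) = 1 / (W p * W p) * x" for x by (simp add: c_def)
      show ?thesis
        unfolding pd_Y_frame[OF assms] scaleR_scaleR c
        unfolding scaleR_scaleR[symmetric] scaleR_add_right[symmetric]
          frame_combination[OF W_square[OF assms] pd_W[OF assms]] pd_N[OF assms]
        using W_pos[OF assms] by simp
    qed
  qed
  then have "mean_curvature Y N p = hessian_trace p * c"
    unfolding hessian_trace_def using u_xy[OF assms] by algebra
  then show ?thesis by (simp add: c_def)
qed

text \<open>The coordinate fields are (1, 0, a) and (0, 1, b), so the coefficients of a tangent
  vector are its first two components; tangency of the derivative of \<open>Nb\<close> is the
  relation \<open>eq\<close> for the third. The factor W^3 clears all denominators.\<close>

lemma mean_curvature_X:
  assumes "p \<in> \<Omega>"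
  shows "mean_curvature X Nb p = - hessian_trace p / (W p * W p * W p)"
proof -
  define n where "n = (\<lambda>i. pd i Nb p)"
  have n: "n i $ 1 * (W p * W p * W p) = W p * W p * pd i a p + a p * (a p * pd i a p + b p * pd i b p)"
    "n i $ 2 * (W p * W p * W p) = W p * W p * pd i b p + b p * (a p * pd i a p + b p * pd i b p)"
    "n i $ 3 * (W p * W p * W p) = a p * pd i a p + b p * pd i b p" for i
  proof -
    have "(W p *\<^sub>R n i) $ k = ((vector [pd i a p, pd i b p, 0] :: real^3) - pd i W p *\<^sub>R Nb p) $ k" for k
      unfolding n_def pd_Nb[OF assms] ..
    from this[of 1] this[of 2] this[of 3]
    have "W p * n i $ 1 = pd i a p - pd i W p * (a p / W p)"
      "W p * n i $ 2 = pd i b p - pd i W p * (b p / W p)"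
      "W p * n i $ 3 = - pd i W p * (1 / W p)"
      by (simp_all add: lorentz_gauss_map_def)
    then have "W p * n i $ 1 * W p = pd i a p * W p - pd i W p * a p"
      "W p * n i $ 2 * W p = pd i b p * W p - pd i W p * b p"
      "W p * n i $ 3 * W p = - pd i W p"
      using W_pos[OF assms] by (simp_all add: field_simps)
    then show "n i $ 1 * (W p * W p * W p) = W p * W p * pd i a p + a p * (a p * pd i a p + b p * pd i b p)"
      "n i $ 2 * (W p * W p * W p) = W p * W p * pd i b p + b p * (a p * pd i a p + b p * pd i b p)"
      "n i $ 3 * (W p * W p * W p) = a p * pd i a p + b p * pd i b p"
      using pd_W[OF assms, of i] by algebra+
  qed
  have W3: "W p * W p * W p \<noteq> 0" using W_pos[OF assms] by simp
  have "mean_curvature X Nb p = - n 1 $ 1 + - n 2 $ 2"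
  proof (rule mean_curvature_eq[OF differentiable_XY(1,4)[OF assms],
        where a = "\<lambda>i. - n i $ 1" and b = "\<lambda>i. - n i $ 2"])
    show "inj (frechet_derivative X (at p))"
      by (rule inj_frechet_derivative_of_nondegenerate[OF bounded_bilinear_lorentz
          differentiable_XY(1)[OF assms] nondegenerate(1)[OF assms]])
    have "(n i $ 1 * a p + n i $ 2 * b p) * (W p * W p * W p) = n i $ 3 * (W p * W p * W p)" for i
      using n[of i] W_square[OF assms] by algebra
    then have eq: "n i $ 1 * a p + n i $ 2 * b p = n i $ 3" for i
      using W3 by (simp only: mult_cancel_right) simp
    show "- n i $ 1 *\<^sub>R pd 1 X p + - n i $ 2 *\<^sub>R pd 2 X p = - pd i Nb p" for i
      unfolding vec_eq_3 using eq[of i] by (simp add: pd_X[OF assms] n_def)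
  qed
  moreover have "(- n 1 $ 1 + - n 2 $ 2) * (W p * W p * W p) = - hessian_trace p"
    using n(1)[of 1] n(2)[of 2] W_square[OF assms] u_xy[OF assms]
    unfolding hessian_trace_def by algebra
  ultimately show ?thesis using W3 by (simp only: eq_divide_eq) simp
qed

text \<open>All second derivatives are vertical, so the leading terms give - D and the correction is
  D times the squared length of the gradient of \<open>u\<close> in the inverse metric, which is (1
  - W^2) / W^2.\<close>

lemma gauss_curvature_X:
  assumes "p \<in> \<Omega>"
  shows "gauss_curvature (induced_metric lorentz X) p
    = - (pd 1 a p * pd 2 b p - pd 1 b p * pd 1 b p) / W p ^ 4"
proof -
  define D where "D = pd 1 a p * pd 2 b p - pd 1 b p * pd 1 b p"
  define w where "w = W p * W p"
  have w: "w \<noteq> 0" "w = 1 - a p * a p - b p * b p" using W_pos[OF assms] W_square[OF assms] by (auto simp: w_def)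
  have "w * gauss_curvature (induced_metric lorentz X) p
      = - D - ((1 - b p * b p) / w * (D * (a p * a p)) + 2 * (a p * b p / w * (D * (a p * b p)))
              + (1 - a p * a p) / w * (D * (b p * b p)))"
    using gauss_curvature_induced_metric[OF open_\<Omega> assms smooth_X bounded_bilinear_lorentz
        lorentz_commute nondegenerate(1)] u_xy[OF assms]
    unfolding sum_2 inv_metric_X[OF assms] pd_pd_X[OF assms] pd_X[OF assms] det_metric_X[OF assms]
      lorentz_def w_def[symmetric] D_def
    by (simp add: algebra_simps)
  also have "\<dots> = - D - D * (((1 - b p * b p) * (a p * a p) + 2 * (a p * b p * (a p * b p))
      + (1 - a p * a p) * (b p * b p)) / w)"
    unfolding divide_inverse by algebra
  also have "(1 - b p * b p) * (a p * a p) + 2 * (a p * b p * (a p * b p)) + (1 - a p * a p) * (b p * b p)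
      = 1 - w"
    using w(2) by algebra
  also have "- D - D * ((1 - w) / w) = - D / w"
    using w(1) by (simp add: field_simps)
  finally have "gauss_curvature (induced_metric lorentz X) p = - D / (w * w)"
    using w(1) by (simp add: field_simps)
  then show ?thesis by (simp add: D_def w_def power4_eq_xxxx algebra_simps)
qed

text \<open>Splitting off the unit normal \<open>N\<close> leaves the tangential part, written with
  the inverse metric exactly as in \<open>gauss_curvature_induced_metric\<close>. There it cancels
  the double sum and leaves the determinant of the scalar second fundamental form.\<close>

lemma inner_resolution:
  assumes "p \<in> \<Omega>"
  shows "v \<bullet> w = (\<Sum>k\<in>UNIV. \<Sum>l\<in>UNIV. matrix_inv (induced_metric inner Y p) $ k $ l *
      ((w \<bullet> pd l Y p) * (v \<bullet> pd k Y p))) + (v \<bullet> N p) * (w \<bullet> N p)"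
proof -
  define e1 e2 n where "e1 = frame1 (a p) (b p) (W p)" and "e2 = frame2 (a p) (b p) (W p)"
    and "n = N p"
  have Wn: "W p \<noteq> 0" using W_pos[OF assms] by simp
  note sq = W_square[OF assms]
  have n: "n = vector [- a p, - b p, W p]" by (simp add: n_def dual_gauss_map_def)
  obtain x y where v: "v = (v \<bullet> n) *\<^sub>R n + x *\<^sub>R e1 + y *\<^sub>R e2"
    using frame_expansion[OF sq Wn, of v] unfolding n e1_def e2_def by blast
  have en: "e1 \<bullet> n = 0" "e2 \<bullet> n = 0" "n \<bullet> e1 = 0" "n \<bullet> e2 = 0"
    unfolding n e1_def e2_def using inner_frame_normal[OF sq] by (simp_all add: inner_commute)
  have "v \<bullet> e1 = x * (e1 \<bullet> e1) + y * (e2 \<bullet> e1)" "v \<bullet> e2 = x * (e1 \<bullet> e2) + y * (e2 \<bullet> e2)"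
    by (subst v, simp add: inner_add_left en)+
  then have ve: "v \<bullet> e1 = x * (1 - a p * a p) - y * (a p * b p)"
    "v \<bullet> e2 = y * (1 - b p * b p) - x * (a p * b p)"
    using inner_frame[OF sq] by (simp_all add: e1_def e2_def)
  have vw: "v \<bullet> w = (v \<bullet> n) * (w \<bullet> n) + x * (w \<bullet> e1) + y * (w \<bullet> e2)"
    by (subst v) (simp add: inner_add_left inner_add_right inner_commute)
  define s t where "s = w \<bullet> e1" and "t = w \<bullet> e2"
  have cancel: "q / (E p * E p) * ((E p / W p * s) * (E p / W p * t)) = q * s * t / (W p * W p)" for q s t
    by simp
  have "(\<Sum>k\<in>UNIV. \<Sum>l\<in>UNIV. matrix_inv (induced_metric inner Y p) $ k $ l *
      ((w \<bullet> pd l Y p) * (v \<bullet> pd k Y p)))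
    = ((1 - b p * b p) * s * (v \<bullet> e1) + a p * b p * t * (v \<bullet> e1)
       + (a p * b p * s * (v \<bullet> e2) + (1 - a p * a p) * t * (v \<bullet> e2))) / (W p * W p)"
    unfolding sum_2 inv_metric_Y[OF assms] pd_Y_frame[OF assms] e1_def[symmetric] e2_def[symmetric]
      inner_scaleR_right cancel add_divide_distrib s_def t_def ..
  also have "(1 - b p * b p) * s * (v \<bullet> e1) + a p * b p * t * (v \<bullet> e1)
       + (a p * b p * s * (v \<bullet> e2) + (1 - a p * a p) * t * (v \<bullet> e2)) = (x * s + y * t) * (W p * W p)"
    unfolding ve sq by algebra
  finally show ?thesis
    using Wn vw by (simp add: s_def t_def n_def)
qed

lemma gauss_curvature_Y:
  assumes "p \<in> \<Omega>"
  shows "gauss_curvature (induced_metric inner Y) p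
    = (pd 1 a p * pd 2 b p - pd 1 b p * pd 1 b p) / (E p * E p)"
proof -
  define D where "D = pd 1 a p * pd 2 b p - pd 1 b p * pd 1 b p"
  define k where "k = E p / W p"
  have "det (induced_metric inner Y p) * gauss_curvature (induced_metric inner Y) p
     = (pd 1 (pd 1 Y) p \<bullet> N p) * (pd 2 (pd 2 Y) p \<bullet> N p) - (pd 1 (pd 2 Y) p \<bullet> N p) * (pd 1 (pd 2 Y) p \<bullet> N p)"
    using gauss_curvature_induced_metric[OF open_\<Omega> assms smooth_Y bounded_bilinear_inner
        inner_commute nondegenerate(2)]
      inner_resolution[OF assms, of "pd 1 (pd 1 Y) p" "pd 2 (pd 2 Y) p"]
      inner_resolution[OF assms, of "pd 1 (pd 2 Y) p" "pd 1 (pd 2 Y) p"]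
    by (simp add: right_diff_distrib sum_subtractf)
  also have "\<dots> = k * k * D"
    unfolding inner_pd_pd_Y_N[OF assms] by (simp add: k_def[symmetric] D_def algebra_simps)
  finally have "E p ^ 4 / (W p * W p) * gauss_curvature (induced_metric inner Y) p = E p * E p / (W p * W p) * D"
    by (simp add: det_metric_Y[OF assms] k_def)
  then have "E p * E p * gauss_curvature (induced_metric inner Y) p = D"
    using W_pos[OF assms] by (simp add: power4_eq_xxxx)
  then show ?thesis by (simp add: D_def field_simps)
qed

lemma curvature_relations:
  assumes "p \<in> \<Omega>"
  shows "mean_curvature Y N p + exp (- \<phi> (u p)) * (W p)\<^sup>2 * mean_curvature X Nb p = 0"
    "gauss_curvature (induced_metric inner Y) p
      + exp (- 2 * \<phi> (u p)) * W p ^ 4 * gauss_curvature (induced_metric lorentz X) p = 0"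
proof -
  have E: "exp (- \<phi> (u p)) = 1 / E p" "exp (- 2 * \<phi> (u p)) = 1 / (E p * E p)"
    by (simp_all add: exp_minus inverse_eq_divide exp_double power2_eq_square)
  show "mean_curvature Y N p + exp (- \<phi> (u p)) * (W p)\<^sup>2 * mean_curvature X Nb p = 0"
    "gauss_curvature (induced_metric inner Y) p
      + exp (- 2 * \<phi> (u p)) * W p ^ 4 * gauss_curvature (induced_metric lorentz X) p = 0"
    unfolding E mean_curvature_X[OF assms] mean_curvature_Y[OF assms]
      gauss_curvature_X[OF assms] gauss_curvature_Y[OF assms]
    using W_pos[OF assms] by (simp_all add: power2_eq_square flip: add_divide_distrib)
qed

section \<open>Injectivity of the Legendre map and the graph property\<close>

lemma hessian_pos:
  assumes "p \<in> \<Omega>" "v \<noteq> 0"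
  shows "v $ 1 * frechet_derivative (pd 1 \<phi>b) (at p) v
    + v $ 2 * frechet_derivative (pd 2 \<phi>b) (at p) v > 0"
proof -
  have "v $ 1 * frechet_derivative (pd 1 \<phi>b) (at p) v + v $ 2 * frechet_derivative (pd 2 \<phi>b) (at p) v
    = E p / W p * ((v $ 1)\<^sup>2 * (1 - (a p)\<^sup>2) - 2 * (v $ 1 * v $ 2 * a p * b p) + (v $ 2)\<^sup>2 * (1 - (b p)\<^sup>2))"
    unfolding frechet_derivative_pd[OF differentiable_pd_\<phi>b[OF assms(1)]]
    by (simp add: \<phi>b_xx \<phi>b_xy \<phi>b_yx \<phi>b_yy assms(1) power2_eq_square algebra_simps diff_divide_distrib add_divide_distrib)
  then show ?thesis using metric_pos[OF assms] W_pos[OF assms(1)] by simp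
qed

lemma inj_on_legendre_map:
  assumes "open U" "U \<subseteq> \<Omega>" "legendre_admissible \<phi>b U"
  shows "inj_on (legendre_map \<phi>b) U"
proof -
  note d = differentiable_\<phi>b[OF subsetD[OF assms(2)]] differentiable_pd_\<phi>b[OF subsetD[OF assms(2)]]
    hessian_pos[OF subsetD[OF assms(2)]]
  show ?thesis
    using assms(3) inj_on_gradient_convex[OF d(2,2,3)] inj_on_gradient_convex_function[OF assms(1) d(1,2,2,3)]
    unfolding legendre_admissible_def by blast
qed

lemma smooth_legendre_map: "smooth_on (legendre_map \<phi>b) \<Omega>"
  unfolding legendre_map_def[abs_def] by (intro smooth_on_vector_2 smooth_pd_\<phi>b open_\<Omega>)

lemma frechet_derivative_legendre_map:
  assumes "p \<in> \<Omega>"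
  shows "frechet_derivative (legendre_map \<phi>b) (at p) v = (E p / W p) *\<^sub>R
    vector [(1 - a p * a p) * v $ 1 - a p * b p * v $ 2, (1 - b p * b p) * v $ 2 - a p * b p * v $ 1]"
proof -
  have "(\<lambda>q. pd i \<phi>b q) = pd i \<phi>b" for i by simp
  then show ?thesis
    unfolding frechet_derivative_pd[OF smooth_on_differentiable[OF smooth_legendre_map assms]]
    by (simp add: vec_eq_2 pd_nth_on[OF smooth_legendre_map assms])
      (simp add: legendre_map_def \<phi>b_xx \<phi>b_xy \<phi>b_yx \<phi>b_yy assms power2_eq_square
        algebra_simps diff_divide_distrib add_divide_distrib)
qed

lemma graph_Y:
  assumes U: "open U" "connected U" "U \<subseteq> \<Omega>" "legendre_admissible \<phi>b U"
  shows "is_graph_over Y U (legendre_domain \<phi>b U)"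
proof -
  let ?L = "legendre_map \<phi>b"
  note inj = inj_on_legendre_map[OF U(1,3,4)]
  have in_\<Omega>: "x \<in> \<Omega>" if "x \<in> U" for x using that U(3) by blast
  \<comment> \<open>The inverse Jacobian of the Legendre map: the Jacobian is E / W times a matrix
    of determinant W^2, so its inverse is the cofactor matrix of the latter divided by E W.\<close>
  define M :: "real^2 \<Rightarrow> real^2 \<Rightarrow> real^2" where
    "M p v = (1 / (E p * W p)) *\<^sub>R
      vector [(1 - b p * b p) * v $ 1 + a p * b p * v $ 2, a p * b p * v $ 1 + (1 - a p * a p) * v $ 2]" for p v
  have "bounded_linear (M p)" for p
    unfolding linear_conv_bounded_linear[symmetric] M_def
    by (rule linearI) (simp_all add: vec_eq_2 algebra_simps add_divide_distrib)
  moreover have "M p \<circ> frechet_derivative ?L (at p) = id" if p: "p \<in> U" for p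
  proof (rule ext)
    fix v :: "real^2"
    have W: "W p \<noteq> 0" using W_pos[OF in_\<Omega>[OF p]] by simp
    define s t where "s = (1 - a p * a p) * v $ 1 - a p * b p * v $ 2"
      and "t = (1 - b p * b p) * v $ 2 - a p * b p * v $ 1"
    have st: "(1 - b p * b p) * s + a p * b p * t = W p * W p * v $ 1"
      "a p * b p * s + (1 - a p * a p) * t = W p * W p * v $ 2"
      unfolding s_def t_def W_square[OF in_\<Omega>[OF p]] by algebra+
    have "M p (c *\<^sub>R vector [s, t]) = (c / (E p * W p)) *\<^sub>R
        vector [(1 - b p * b p) * s + a p * b p * t, a p * b p * s + (1 - a p * a p) * t]" for c
      by (simp add: M_def vec_eq_2 algebra_simps)
    then show "(M p \<circ> frechet_derivative ?L (at p)) v = id v"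
      unfolding o_def frechet_derivative_legendre_map[OF in_\<Omega>[OF p]] s_def[symmetric] t_def[symmetric] st
      using W by (simp add: vec_eq_2)
  qed
  moreover have "smooth_on (\<lambda>x. frechet_derivative g (at x) (M x v)) U" if g: "smooth_on g U"
    for g :: "real^2 \<Rightarrow> real" and v
  proof (rule smooth_on_cong[OF U(1)])
    note sm = smooth_on_subset[OF smooth_ab U(3)] smooth_on_subset[OF smooth_W U(3)]
      smooth_on_subset[OF smooth_E U(3)]
    \<comment> \<open>The direction \<open>M x v\<close> varies with \<open>x\<close>, so the
      derivative is written through the partial derivatives of \<open>g\<close>, to which the
      closure rules apply.\<close>
    show "smooth_on (\<lambda>x. M x v $ 1 * pd 1 g x + M x v $ 2 * pd 2 g x) U"
      unfolding M_def vector_scaleR_component vector_2 real_scaleR_def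
      by (intro smooth_on_add smooth_on_mult smooth_on_divide smooth_on_diff smooth_on_const sm
          smooth_on_pd[OF g] U(1) mult_pos_pos exp_gt_zero W_pos in_\<Omega>; assumption)+
    show "M x v $ 1 * pd 1 g x + M x v $ 2 * pd 2 g x = frechet_derivative g (at x) (M x v)"
      if "x \<in> U" for x
      using frechet_derivative_pd[OF smooth_on_differentiable[OF g that]] by simp
  qed
  ultimately have *: "open (?L ` U)"
    "smooth_on (\<lambda>y. \<theta> (u (inv_into U ?L y))) (?L ` U)"
    using smooth_on_compose_inv_into[OF U(1) inj smooth_on_has_derivative[OF smooth_legendre_map in_\<Omega>],
        of M "\<lambda>p. \<theta> (u p)"] smooth_on_subset[OF smooth_\<theta>u U(3)] by blast+
  have "continuous_on U ?L"
    by (intro continuous_at_imp_continuous_on ballI differentiable_imp_continuous_within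
        smooth_on_differentiable[OF smooth_legendre_map] in_\<Omega>)
  then have "connected (?L ` U)" by (rule connected_continuous_image[OF _ U(2)])
  moreover have "inj_on Y U"
  proof (rule inj_onI)
    fix p q assume pq: "p \<in> U" "q \<in> U" "Y p = Y q"
    then have "?L p = ?L q" by (simp add: dual_surface_def legendre_map_def vec_eq_3 vec_eq_2)
    then show "p = q" using inj_onD[OF inj] pq by blast
  qed
  \<comment> \<open>The first two coordinates of \<open>Y p\<close> are its image under the Legendre
    map, from which \<open>inv_into\<close> recovers \<open>p\<close>.\<close>
  moreover have "Y ` U = graph_param (\<lambda>y. \<theta> (u (inv_into U ?L y))) ` ?L ` U"
    unfolding image_image
    by (rule image_cong) (simp_all add: inj graph_param_def dual_surface_def, simp add: legendre_map_def)
  ultimately show ?thesis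
    unfolding is_graph_over_def using * by blast
qed

end

theorem theorem4p4:
  fixes \<Omega> :: "(real^2) set" and I :: "real set"
    and \<phi> \<theta> :: "real \<Rightarrow> real" and u \<phi>b :: "real^2 \<Rightarrow> real"
  assumes dom: "open \<Omega>" "connected \<Omega>" "\<Omega> \<noteq> {}" "simply_connected \<Omega>"
    and interval: "open I" "is_interval I"
    and maximal: "maximal_on I \<phi> (graph_param u) \<Omega>"
    and \<phi>b_C2: "Ck_on 2 \<phi>b \<Omega>"
    and \<phi>b_xx: "\<forall>p\<in>\<Omega>. pd 1 (pd 1 \<phi>b) p = (1 - (pd 1 u p)\<^sup>2) / W_bar u p * exp (\<phi> (u p))"
    and \<phi>b_xy: "\<forall>p\<in>\<Omega>. pd 2 (pd 1 \<phi>b) p = - (pd 1 u p * pd 2 u p / W_bar u p) * exp (\<phi> (u p))"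
    and \<phi>b_yy: "\<forall>p\<in>\<Omega>. pd 2 (pd 2 \<phi>b) p = (1 - (pd 2 u p)\<^sup>2) / W_bar u p * exp (\<phi> (u p))"
    and primitive: "\<forall>t\<in>I. (\<theta> has_real_derivative exp (\<phi> t)) (at t)"
  shows "minimal_on (\<theta> ` I) (\<lambda>s. - \<phi> (inv_into I \<theta> s)) (dual_surface \<phi>b \<theta> u) \<Omega>
    \<and> (\<forall>U. open U \<and> connected U \<and> U \<subseteq> \<Omega> \<and> legendre_admissible \<phi>b U \<longrightarrow>
          is_graph_over (dual_surface \<phi>b \<theta> u) U (legendre_domain \<phi>b U))
    \<and> (\<forall>p\<in>\<Omega>.
          induced_metric inner (dual_surface \<phi>b \<theta> u) p
            = (exp (2 * \<phi> (u p)) / (W_bar u p)\<^sup>2) *\<^sub>R induced_metric lorentz (graph_param u) p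
        \<and> mean_curvature (dual_surface \<phi>b \<theta> u) (dual_gauss_map u) p
            + exp (- \<phi> (u p)) * (W_bar u p)\<^sup>2
              * mean_curvature (graph_param u) (lorentz_gauss_map u) p = 0
        \<and> gauss_curvature (induced_metric inner (dual_surface \<phi>b \<theta> u)) p
            + exp (- 2 * \<phi> (u p)) * (W_bar u p)^4
              * gauss_curvature (induced_metric lorentz (graph_param u)) p = 0)"
proof -
  interpret dual_graph \<Omega> I \<phi> \<theta> u \<phi>b
    by unfold_locales (use assms in auto)
  show ?thesis
    using minimal_Y[unfolded dual_weight_def[abs_def]] graph_Y metric_Y curvature_relations by blast
qed

end
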